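(* Let $m\ge0$ and $\theta\in(-\frac{\pi}{2},\frac{\pi}{2})$ with $\theta\ne0$. Then the eigenfunctions of $H_\theta$ form neither a Riesz basis nor a Schauder basis of $L^2(\mathbb{R})^4$; that is, no sequence consisting of eigenfunctions of $H_\theta$ is a Riesz basis or a Schauder basis of $L^2(\mathbb{R})^4$.
   Context: Pauli matrices: $\sigma_1=\begin{pmatrix}0&1\\1&0\end{pmatrix}$, $\sigma_2=\begin{pmatrix}0&-i\\i&0\end{pmatrix}$, $\sigma_3=\begin{pmatrix}1&0\\0&-1\end{pmatrix}$; Dirac matrices $\alpha_k=\begin{pmatrix}0&\sigma_k\\\sigma_k&0\end{pmatrix}$, $k=1,2,3$. For $m\ge0$ and $|\theta|<\frac{\pi}{2}$, the operator $H_\theta$ acts in $L^2(\mathbb{R})^4=L^2(\mathbb{R};\mathbb{C}^4)$ by $$H_\theta=-i\alpha_1e^{-i\theta/2}\partial_x-\alpha_2e^{i\theta/2}x+m\alpha_3,\qquad \mathsf{D}(H_\theta)=\mathcal{D}^4,\quad \mathcal{D}=H^1(\mathbb{R})\cap L^2(\mathbb{R},x^2\,dx).$$ *)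

theory Defs
  imports "HOL-Analysis.Analysis"
begin

definition sigma1 :: "complex^2^2" where
  "sigma1 = vector [vector [0, 1], vector [1, 0]]"

definition sigma2 :: "complex^2^2" where
  "sigma2 = vector [vector [0, - \<i>], vector [\<i>, 0]]"

definition sigma3 :: "complex^2^2" where
  "sigma3 = vector [vector [1, 0], vector [0, - 1]]"

definition block_matrix ::
  "complex^2^2 \<Rightarrow> complex^2^2 \<Rightarrow> complex^2^2 \<Rightarrow> complex^2^2 \<Rightarrow> complex^4^4" where
  "block_matrix A B C D = vector
     [vector [A$1$1, A$1$2, B$1$1, B$1$2],
      vector [A$2$1, A$2$2, B$2$1, B$2$2],
      vector [C$1$1, C$1$2, D$1$1, D$1$2],
      vector [C$2$1, C$2$2, D$2$1, D$2$2]]"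

definition alpha1 :: "complex^4^4" where "alpha1 = block_matrix 0 sigma1 sigma1 0"
definition alpha2 :: "complex^4^4" where "alpha2 = block_matrix 0 sigma2 sigma2 0"
definition alpha3 :: "complex^4^4" where "alpha3 = block_matrix 0 sigma3 sigma3 0"

text \<open>Elements of an \<open>L\<^sup>2\<close> space are represented by Borel measurable square-integrable
  functions. Equality in \<open>L\<^sup>2\<close> is equality almost everywhere, and the notions below are
  invariant under it.\<close>

definition L2 :: "real measure \<Rightarrow> (real \<Rightarrow> 'a::real_normed_vector) set" where
  "L2 M = {f \<in> borel_measurable M. integrable M (\<lambda>x. (norm (f x))\<^sup>2)}"

definition l2norm :: "(real \<Rightarrow> 'a::real_normed_vector) \<Rightarrow> real" where
  "l2norm f = sqrt (LINT x|lborel. (norm (f x))\<^sup>2)"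

definition l2inner :: "(real \<Rightarrow> complex^4) \<Rightarrow> (real \<Rightarrow> complex^4) \<Rightarrow> complex" where
  "l2inner f g = (LINT x|lborel. (\<Sum>i\<in>UNIV. cnj (f x $ i) * g x $ i))"

text \<open>Real-valued test functions suffice: a complex-valued one splits into its real and
  imaginary parts.\<close>

definition test_function :: "(real \<Rightarrow> real) \<Rightarrow> bool" where
  "test_function \<phi> \<longleftrightarrow>
     compact (closure {x. \<phi> x \<noteq> 0}) \<and> (\<forall>k x. (deriv ^^ k) \<phi> differentiable (at x))"

definition has_weak_deriv :: "(real \<Rightarrow> complex) \<Rightarrow> (real \<Rightarrow> complex) \<Rightarrow> bool" where
  "has_weak_deriv f g \<longleftrightarrow>
     (\<forall>\<phi>. test_function \<phi> \<longrightarrow>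
        (LINT x|lborel. of_real (deriv \<phi> x) * f x) = - (LINT x|lborel. of_real (\<phi> x) * g x))"

definition H1 :: "(real \<Rightarrow> complex) set" where
  "H1 = {f \<in> L2 lborel. \<exists>g \<in> L2 lborel. has_weak_deriv f g}"

text \<open>On \<open>H1\<close> the weak derivative is determined up to a null set.\<close>

definition weak_deriv :: "(real \<Rightarrow> complex) \<Rightarrow> real \<Rightarrow> complex" where
  "weak_deriv f = (SOME g. g \<in> L2 lborel \<and> has_weak_deriv f g)"

definition dom_component :: "(real \<Rightarrow> complex) set" where
  "dom_component = H1 \<inter> L2 (density lborel (\<lambda>x. ennreal (x\<^sup>2)))"

definition dom_H :: "(real \<Rightarrow> complex^4) set" where
  "dom_H = {u. \<forall>i. (\<lambda>x. u x $ i) \<in> dom_component}"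

definition H_op :: "real \<Rightarrow> real \<Rightarrow> (real \<Rightarrow> complex^4) \<Rightarrow> real \<Rightarrow> complex^4" where
  "H_op m \<theta> u x =
     (- \<i> * exp (- \<i> * of_real \<theta> / 2)) *s (alpha1 *v (\<chi> i. weak_deriv (\<lambda>y. u y $ i) x))
     - (exp (\<i> * of_real \<theta> / 2) * of_real x) *s (alpha2 *v u x)
     + of_real m *s (alpha3 *v u x)"

definition eigenfunction :: "real \<Rightarrow> real \<Rightarrow> (real \<Rightarrow> complex^4) \<Rightarrow> bool" where
  "eigenfunction m \<theta> u \<longleftrightarrow>
     u \<in> dom_H \<and> \<not> (AE x in lborel. u x = 0) \<and>
     (\<exists>E::complex. AE x in lborel. H_op m \<theta> u x = E *s u x)"

definition schauder_basis :: "(nat \<Rightarrow> real \<Rightarrow> complex^4) \<Rightarrow> bool" where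
  "schauder_basis e \<longleftrightarrow>
     (\<forall>n. e n \<in> L2 lborel) \<and>
     (\<forall>f \<in> L2 lborel. \<exists>!c :: nat \<Rightarrow> complex.
        (\<lambda>N. l2norm (\<lambda>x. f x - (\<Sum>n<N. c n *s e n x))) \<longlonglongrightarrow> 0)"

definition orthonormal_basis :: "(nat \<Rightarrow> real \<Rightarrow> complex^4) \<Rightarrow> bool" where
  "orthonormal_basis g \<longleftrightarrow>
     (\<forall>n. g n \<in> L2 lborel) \<and>
     (\<forall>j k. l2inner (g j) (g k) = (if j = k then 1 else 0)) \<and>
     (\<forall>f \<in> L2 lborel. (\<forall>n. l2inner (g n) f = 0) \<longrightarrow> (AE x in lborel. f x = 0))"

text \<open>Linearity and boundedness together make such a map well defined on classes modulo
  equality almost everywhere.\<close>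

definition bounded_operator :: "((real \<Rightarrow> complex^4) \<Rightarrow> real \<Rightarrow> complex^4) \<Rightarrow> bool" where
  "bounded_operator T \<longleftrightarrow>
     (\<forall>f \<in> L2 lborel. T f \<in> L2 lborel) \<and>
     (\<forall>f \<in> L2 lborel. \<forall>g \<in> L2 lborel.
        AE x in lborel. T (\<lambda>y. f y + g y) x = T f x + T g x) \<and>
     (\<forall>c. \<forall>f \<in> L2 lborel. AE x in lborel. T (\<lambda>y. c *s f y) x = c *s T f x) \<and>
     (\<exists>C. \<forall>f \<in> L2 lborel. l2norm (T f) \<le> C * l2norm f)"

text \<open>A Riesz basis is the image of an orthonormal basis under a bounded operator with bounded
  inverse.\<close>

definition riesz_basis :: "(nat \<Rightarrow> real \<Rightarrow> complex^4) \<Rightarrow> bool" where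
  "riesz_basis e \<longleftrightarrow>
     (\<forall>n. e n \<in> L2 lborel) \<and>
     (\<exists>g T S. orthonormal_basis g \<and> bounded_operator T \<and> bounded_operator S \<and>
        (\<forall>f \<in> L2 lborel. (AE x in lborel. S (T f) x = f x) \<and> (AE x in lborel. T (S f) x = f x)) \<and>
        (\<forall>n. AE x in lborel. e n x = T (g n) x))"

end

theory Submission
  imports Defs "HOL-Probability.Probability" "HOL-Computational_Algebra.Polynomial"
begin

text \<open>Put \<open>\<omega> = exp (i\<theta>/2)\<close>. The functions \<open>\<psi>\<^sub>n(x) = p\<^sub>n(x) exp (- \<omega>\<^sup>2 x\<^sup>2 / 2)\<close>, with \<open>p\<^sub>n(x)\<close> the Hermite
  polynomial of \<open>\<omega>x\<close>, are biorthogonal to themselves for the bilinear pairing \<open>\<integral>fg\<close> and total in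
  \<open>L\<^sup>2\<close>. Pairing the eigenvalue equation with them and using the ladder operators
  \<open>\<plusminus>\<omega>\<^sup>-\<^sup>1\<partial> + \<omega>x\<close> shows that every eigenfunction has \<open>E\<^sup>2 = m\<^sup>2 + 2n\<close> for some \<open>n\<close> and lies in a
  space of dimension at most 4, its components being multiples of \<open>\<psi>\<^sub>n\<close>, \<open>\<psi>\<^sub>n\<^sub>-\<^sub>1\<close>, \<open>\<psi>\<^sub>n\<close>, \<open>\<psi>\<^sub>n\<^sub>-\<^sub>1\<close>. If
  the eigenfunctions formed a Schauder basis, the terms in the expansion of any function
  \<open>(f,0,0,0)\<close> would be bounded, whence \<open>|\<integral>\<psi>\<^sub>n f|\<^sup>2 \<le> C |\<integral>\<psi>\<^sub>n\<^sup>2| = C' 2\<^sup>n n!\<close>. For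
  \<open>f(x) = exp (- \<beta> x\<^sup>2 / 2)\<close> the left side over the right one grows like
  \<open>|(\<omega>\<^sup>2 - \<beta>) / (\<omega>\<^sup>2 + \<beta>)|\<^sup>n\<close>, up to powers of \<open>n\<close>, along even \<open>n\<close>. As \<open>\<omega>\<^sup>2\<close> is not real, some
  \<open>\<beta>\<close> with \<open>Re \<beta> > 0\<close> makes that base larger than 1. A Riesz basis is in particular a Schauder
  basis.\<close>

section \<open>Square-integrable functions\<close>

text \<open>The sequence of eigenfunctions is arbitrary: its order is free, several members may
  share a level, and nothing is known about the angles between those. Single expansion coefficients
  are therefore out of reach. Pairing the first component with \<open>psi n\<close> avoids them: it
  annihilates every term off level n, and linear independence leaves at most four terms on level n.
  Such a term has first component \<open>v * psi n\<close>, where |v| times the norm of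
  \<open>psi n\<close> is bounded, and contributes v d with d the bilinear square of
  \<open>psi n\<close>. Since |d| is at most the squared norm, the contribution is O(sqrt |d|). The
  constant may depend on f, so one explicit f gives the contradiction, with no appeal to uniform
  boundedness. A suitable \<beta> exists because the base exceeds 1 on the half-plane
  \<open>Re (\<omega>\<^sup>2 * cnj \<beta>) < 0\<close>, which meets \<open>Re \<beta> > 0\<close>
  exactly when \<open>\<omega>\<^sup>2\<close> is not a positive real. Weak derivatives are tested
  only against compactly supported real functions, whereas \<open>psi n\<close> is neither; cutoffs
  and a splitting into real and imaginary parts bridge this gap.\<close>

lemma L2_measurable: "f \<in> L2 lborel \<Longrightarrow> f \<in> borel_measurable lborel"
  by (simp add: L2_def)

lemma L2_integrable: "f \<in> L2 lborel \<Longrightarrow> integrable lborel (\<lambda>x. (norm (f x))\<^sup>2)"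
  by (simp add: L2_def)

lemma L2_dominated:
  fixes f :: "real \<Rightarrow> 'a::euclidean_space" and g :: "real \<Rightarrow> 'b::euclidean_space"
  assumes "f \<in> L2 lborel" "g \<in> borel_measurable lborel"
    and le: "AE x in lborel. norm (g x) \<le> C * norm (f x)"
  shows "g \<in> L2 lborel"
proof -
  note [measurable] = assms(2)
  have "integrable lborel (\<lambda>x. C\<^sup>2 * (norm (f x))\<^sup>2)"
    using L2_integrable[OF assms(1)] by simp
  then have "integrable lborel (\<lambda>x. (norm (g x))\<^sup>2)"
  proof (rule Bochner_Integration.integrable_bound)
    show "AE x in lborel. norm ((norm (g x))\<^sup>2) \<le> norm (C\<^sup>2 * (norm (f x))\<^sup>2)"
      using le
    proof eventually_elim
      case (elim x)
      then have "(norm (g x))\<^sup>2 \<le> (C * norm (f x))\<^sup>2" by (intro power_mono) auto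
      then show ?case by (simp add: power_mult_distrib)
    qed
  qed measurable
  then show ?thesis using assms by (simp add: L2_def)
qed

lemma l2norm_nonneg [simp]: "0 \<le> l2norm f"
  by (simp add: l2norm_def)

lemma l2norm_dominated:
  fixes f :: "real \<Rightarrow> 'a::euclidean_space" and g :: "real \<Rightarrow> 'b::euclidean_space"
  assumes "f \<in> L2 lborel" "g \<in> borel_measurable lborel"
    and le: "AE x in lborel. norm (g x) \<le> C * norm (f x)" and "0 \<le> C"
  shows "l2norm g \<le> C * l2norm f"
proof -
  have "(LINT x|lborel. (norm (g x))\<^sup>2) \<le> (LINT x|lborel. C\<^sup>2 * (norm (f x))\<^sup>2)"
  proof (rule integral_mono_AE)
    show "integrable lborel (\<lambda>x. (norm (g x))\<^sup>2)"
      using L2_dominated[OF assms(1-3)] by (simp add: L2_def)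
    show "integrable lborel (\<lambda>x. C\<^sup>2 * (norm (f x))\<^sup>2)"
      using L2_integrable[OF assms(1)] by simp
    show "AE x in lborel. (norm (g x))\<^sup>2 \<le> C\<^sup>2 * (norm (f x))\<^sup>2"
      using le
    proof eventually_elim
      case (elim x)
      then have "(norm (g x))\<^sup>2 \<le> (C * norm (f x))\<^sup>2" by (intro power_mono) auto
      then show ?case by (simp add: power_mult_distrib)
    qed
  qed
  then have "l2norm g \<le> sqrt (C\<^sup>2 * (LINT x|lborel. (norm (f x))\<^sup>2))"
    by (simp add: l2norm_def)
  then show ?thesis using \<open>0 \<le> C\<close> by (simp add: l2norm_def real_sqrt_mult)
qed

lemma l2norm_cong_AE:
  fixes f g :: "real \<Rightarrow> 'a::euclidean_space"
  assumes "f \<in> borel_measurable lborel" "g \<in> borel_measurable lborel"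
    "AE x in lborel. f x = g x"
  shows "l2norm f = l2norm g"
proof -
  note [measurable] = assms(1,2)
  show ?thesis unfolding l2norm_def using assms(3) by (intro arg_cong[where f=sqrt] integral_cong_AE) auto
qed

lemma L2_add:
  fixes f g :: "real \<Rightarrow> 'a::euclidean_space"
  assumes "f \<in> L2 lborel" "g \<in> L2 lborel"
  shows "(\<lambda>x. f x + g x) \<in> L2 lborel"
proof -
  note [measurable] = assms[THEN L2_measurable]
  have "integrable lborel (\<lambda>x. 2 * (norm (f x))\<^sup>2 + 2 * (norm (g x))\<^sup>2)"
    using assms[THEN L2_integrable] by simp
  then have "integrable lborel (\<lambda>x. (norm (f x + g x))\<^sup>2)"
  proof (rule Bochner_Integration.integrable_bound)
    show "AE x in lborel. norm ((norm (f x + g x))\<^sup>2) \<le> norm (2 * (norm (f x))\<^sup>2 + 2 * (norm (g x))\<^sup>2)"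
    proof (rule AE_I2)
      fix x
      have "(norm (f x + g x))\<^sup>2 \<le> (norm (f x) + norm (g x))\<^sup>2"
        by (intro power_mono norm_triangle_ineq) auto
      also have "\<dots> \<le> 2 * (norm (f x))\<^sup>2 + 2 * (norm (g x))\<^sup>2"
        using sum_squares_bound[of "norm (f x)" "norm (g x)"] by (simp add: power2_sum)
      finally show "norm ((norm (f x + g x))\<^sup>2) \<le> norm (2 * (norm (f x))\<^sup>2 + 2 * (norm (g x))\<^sup>2)"
        by simp
    qed
  qed measurable
  then show ?thesis by (simp add: L2_def)
qed

lemma L2_uminus:
  fixes f :: "real \<Rightarrow> 'a::euclidean_space"
  shows "f \<in> L2 lborel \<Longrightarrow> (\<lambda>x. - f x) \<in> L2 lborel"
  by (simp add: L2_def)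

lemma L2_diff:
  fixes f g :: "real \<Rightarrow> 'a::euclidean_space"
  assumes "f \<in> L2 lborel" "g \<in> L2 lborel"
  shows "(\<lambda>x. f x - g x) \<in> L2 lborel"
  using L2_add[OF assms(1) L2_uminus[OF assms(2)]] by simp

lemma L2_zero [simp]: "(\<lambda>x. 0 :: 'a::euclidean_space) \<in> L2 lborel"
  by (simp add: L2_def)

lemma L2_sum:
  fixes f :: "'i \<Rightarrow> real \<Rightarrow> 'a::euclidean_space"
  assumes "\<And>i. i \<in> I \<Longrightarrow> f i \<in> L2 lborel"
  shows "(\<lambda>x. \<Sum>i\<in>I. f i x) \<in> L2 lborel"
  using assms by (induction I rule: infinite_finite_induct) (auto intro: L2_add)

lemma L2_norm_mult_integrable:
  fixes f :: "real \<Rightarrow> 'a::euclidean_space" and g :: "real \<Rightarrow> 'b::euclidean_space"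
  assumes "f \<in> L2 lborel" "g \<in> L2 lborel"
  shows "integrable lborel (\<lambda>x. norm (f x) * norm (g x))"
proof -
  note [measurable] = assms[THEN L2_measurable]
  have "integrable lborel (\<lambda>x. (norm (f x))\<^sup>2 + (norm (g x))\<^sup>2)"
    using assms[THEN L2_integrable] by simp
  then show ?thesis
  proof (rule Bochner_Integration.integrable_bound)
    show "AE x in lborel. norm (norm (f x) * norm (g x)) \<le> norm ((norm (f x))\<^sup>2 + (norm (g x))\<^sup>2)"
    proof (rule AE_I2)
      fix x show "norm (norm (f x) * norm (g x)) \<le> norm ((norm (f x))\<^sup>2 + (norm (g x))\<^sup>2)"
        using sum_squares_bound[of "norm (f x)" "norm (g x)"] mult_nonneg_nonneg[of "norm (f x)" "norm (g x)"]
        by (simp del: mult_nonneg_nonneg)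
    qed
  qed measurable
qed

lemma L2_mult_integrable:
  fixes f g :: "real \<Rightarrow> complex"
  assumes "f \<in> L2 lborel" "g \<in> L2 lborel"
  shows "integrable lborel (\<lambda>x. f x * g x)"
proof -
  note [measurable] = assms[THEN L2_measurable]
  show ?thesis
    by (rule Bochner_Integration.integrable_bound[OF L2_norm_mult_integrable[OF assms]]) (auto simp: norm_mult)
qed

lemma l2norm_squared: "(l2norm f)\<^sup>2 = (LINT x|lborel. (norm (f x))\<^sup>2)"
  by (simp add: l2norm_def integral_nonneg_AE)

lemma l2norm_eq_0:
  fixes f :: "real \<Rightarrow> 'a::euclidean_space"
  assumes "f \<in> L2 lborel"
  shows "l2norm f = 0 \<longleftrightarrow> (AE x in lborel. f x = 0)"
proof -
  note [measurable] = assms[THEN L2_measurable]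
  have "l2norm f = 0 \<longleftrightarrow> (LINT x|lborel. (norm (f x))\<^sup>2) = 0"
    by (simp add: l2norm_def)
  also have "\<dots> \<longleftrightarrow> (AE x in lborel. (norm (f x))\<^sup>2 = 0)"
    by (rule integral_nonneg_eq_0_iff_AE) (auto simp: L2_integrable[OF assms])
  finally show ?thesis by simp
qed

lemma L2_Cauchy_Schwarz:
  fixes f :: "real \<Rightarrow> 'a::euclidean_space" and g :: "real \<Rightarrow> 'b::euclidean_space"
  assumes f: "f \<in> L2 lborel" and g: "g \<in> L2 lborel"
  shows "(LINT x|lborel. norm (f x) * norm (g x)) \<le> l2norm f * l2norm g"
proof -
  define P where "P = (LINT x|lborel. norm (f x) * norm (g x))"
  define A where "A = (l2norm f)\<^sup>2"
  define B where "B = (l2norm g)\<^sup>2"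
  note int = f[THEN L2_integrable] g[THEN L2_integrable] L2_norm_mult_integrable[OF f g]
  \<comment> \<open>Two parameters instead of one keep the quadratic form free of division, so that
    \<open>B = 0\<close> can be treated with it as well.\<close>
  have q: "0 \<le> s\<^sup>2 * A - 2 * s * t * P + t\<^sup>2 * B" for s t
  proof -
    have "0 \<le> (LINT x|lborel. (s * norm (f x) - t * norm (g x))\<^sup>2)" by simp
    also have "\<dots> = (LINT x|lborel. s\<^sup>2 * (norm (f x))\<^sup>2 - (2 * s * t) * (norm (f x) * norm (g x)) + t\<^sup>2 * (norm (g x))\<^sup>2)"
      by (rule Bochner_Integration.integral_cong) (auto simp: power2_eq_square algebra_simps)
    also have "\<dots> = s\<^sup>2 * A - 2 * s * t * P + t\<^sup>2 * B"
      using int by (simp add: A_def B_def P_def l2norm_squared)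
    finally show ?thesis .
  qed
  have AB: "0 \<le> A" "0 \<le> B" by (auto simp: A_def B_def)
  have "P\<^sup>2 \<le> A * B"
  proof (cases "B = 0")
    case True
    then have "0 \<le> s\<^sup>2 * A - 2 * s * P" for s using q[of s 1] by simp
    show ?thesis
    proof (cases "P = 0")
      case False
      \<comment> \<open>For \<open>B = 0\<close> the form is linear in t; the value
        \<open>t = (A + 1) / 2\<close> turns it into \<open>- P\<^sup>2\<close>.\<close>
      have "0 \<le> P\<^sup>2 * A - 2 * t * P\<^sup>2" for t using q[of P t] True by (simp add: power2_eq_square mult_ac)
      from this[of "(A+1)/2"] have "P\<^sup>2 \<le> 0" by (simp add: algebra_simps)
      then show ?thesis using False by simp
    qed (use True in simp)
  next
    case False
    \<comment> \<open>Up to scaling, \<open>s = B\<close> and \<open>t = P\<close> is the minimizer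
      of the form.\<close>
    have "0 \<le> B\<^sup>2 * A - 2 * B * P * P + P\<^sup>2 * B" by (rule q)
    then have "0 \<le> B * (A * B - P\<^sup>2)" by (simp add: power2_eq_square algebra_simps)
    then show ?thesis using False AB by (simp add: zero_le_mult_iff)
  qed
  then have "P\<^sup>2 \<le> (l2norm f * l2norm g)\<^sup>2" by (simp add: A_def B_def power_mult_distrib)
  then show ?thesis unfolding P_def[symmetric] by (rule power2_le_imp_le) auto
qed

lemma l2norm_triangle:
  fixes f g :: "real \<Rightarrow> 'a::euclidean_space"
  assumes f: "f \<in> L2 lborel" and g: "g \<in> L2 lborel"
  shows "l2norm (\<lambda>x. f x + g x) \<le> l2norm f + l2norm g"
proof -
  note int = f[THEN L2_integrable] g[THEN L2_integrable] L2_norm_mult_integrable[OF f g]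
  have "(l2norm (\<lambda>x. f x + g x))\<^sup>2 \<le> (LINT x|lborel. (norm (f x))\<^sup>2 + 2 * (norm (f x) * norm (g x)) + (norm (g x))\<^sup>2)"
    unfolding l2norm_squared
  proof (rule integral_mono)
    show "integrable lborel (\<lambda>x. (norm (f x + g x))\<^sup>2)"
      by (rule L2_integrable[OF L2_add[OF f g]])
    fix x
    have "(norm (f x + g x))\<^sup>2 \<le> (norm (f x) + norm (g x))\<^sup>2"
      by (intro power_mono norm_triangle_ineq) auto
    then show "(norm (f x + g x))\<^sup>2 \<le> (norm (f x))\<^sup>2 + 2 * (norm (f x) * norm (g x)) + (norm (g x))\<^sup>2"
      by (simp add: power2_sum)
  qed (use int in simp)
  also have "\<dots> = (l2norm f)\<^sup>2 + 2 * (LINT x|lborel. norm (f x) * norm (g x)) + (l2norm g)\<^sup>2"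
    using int by (simp add: l2norm_squared)
  also have "\<dots> \<le> (l2norm f + l2norm g)\<^sup>2"
    using L2_Cauchy_Schwarz[OF f g] by (simp add: power2_sum)
  finally show ?thesis by (rule power2_le_imp_le) auto
qed

lemma l2norm_minus_commute: "l2norm (\<lambda>x. f x - g x) = l2norm (\<lambda>x. g x - f x)"
  by (simp add: l2norm_def norm_minus_commute)

lemma l2norm_triangle_sub:
  fixes f g h :: "real \<Rightarrow> 'a::euclidean_space"
  assumes "f \<in> L2 lborel" "g \<in> L2 lborel" "h \<in> L2 lborel"
  shows "l2norm (\<lambda>x. f x - h x) \<le> l2norm (\<lambda>x. f x - g x) + l2norm (\<lambda>x. g x - h x)"
  using l2norm_triangle[OF L2_diff[OF assms(1,2)] L2_diff[OF assms(2,3)]] by simp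

text \<open>Riesz--Fischer. A subsequence with \<open>\<parallel>f (r (k+1)) - f (r k)\<parallel>\<^sup>2 < 8^(-k)\<close> has
  \<open>\<Sum>k. 4^k * \<parallel>f (r (k+1)) - f (r k)\<parallel>\<^sup>2\<close> finite, so it converges almost everywhere, and Fatou's lemma
  identifies its limit as the limit in norm.\<close>

lemma L2_complete:
  fixes f :: "nat \<Rightarrow> real \<Rightarrow> 'a::euclidean_space"
  assumes f: "\<And>n. f n \<in> L2 lborel"
    and Cauchy: "\<And>e. 0 < e \<Longrightarrow> \<exists>N. \<forall>m\<ge>N. \<forall>n\<ge>N. l2norm (\<lambda>x. f m x - f n x) < e"
  shows "\<exists>F \<in> L2 lborel. (\<lambda>n. l2norm (\<lambda>x. f n x - F x)) \<longlonglongrightarrow> 0"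
proof -
  note [measurable] = f[THEN L2_measurable]
  have "\<exists>r :: nat \<Rightarrow> nat. \<forall>k. (\<forall>m\<ge>r k. \<forall>n\<ge>r k. l2norm (\<lambda>x. f m x - f n x) < sqrt ((1/8)^k)) \<and> r k < r (Suc k)"
  proof (rule dependent_nat_choice)
    show "\<exists>N. \<forall>m\<ge>N. \<forall>n\<ge>N. l2norm (\<lambda>x. f m x - f n x) < sqrt ((1/8)^0)"
      by (rule Cauchy) simp
    fix N k
    obtain M where "\<forall>m\<ge>M. \<forall>n\<ge>M. l2norm (\<lambda>x. f m x - f n x) < sqrt ((1/8)^Suc k)"
      using Cauchy[of "sqrt ((1/8)^Suc k)"] by auto
    then show "\<exists>M. (\<forall>m\<ge>M. \<forall>n\<ge>M. l2norm (\<lambda>x. f m x - f n x) < sqrt ((1/8)^Suc k)) \<and> N < M"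
      by (intro exI[of _ "max M (Suc N)"]) auto
  qed
  then obtain r :: "nat \<Rightarrow> nat" where
    r: "\<And>k m n. r k \<le> m \<Longrightarrow> r k \<le> n \<Longrightarrow> l2norm (\<lambda>x. f m x - f n x) < sqrt ((1/8)^k)"
    and rS: "\<And>k. r k < r (Suc k)" by blast
  have mono: "strict_mono r" using rS by (simp add: strict_mono_Suc_iff)
  define d where "d k x = f (r (Suc k)) x - f (r k) x" for k x
  have [measurable]: "d k \<in> borel_measurable lborel" for k unfolding d_def by measurable
  have "AE x in lborel. (\<Sum>k. ennreal (4^k * (norm (d k x))\<^sup>2)) \<noteq> \<infinity>"
  proof (rule nn_integral_PInf_AE)
    have "(\<integral>\<^sup>+ x. (\<Sum>k. ennreal (4^k * (norm (d k x))\<^sup>2)) \<partial>lborel)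
        = (\<Sum>k. \<integral>\<^sup>+ x. ennreal (4^k * (norm (d k x))\<^sup>2) \<partial>lborel)"
      by (rule nn_integral_suminf) measurable
    also have "\<dots> \<le> (\<Sum>k. ennreal ((1/2)^k))"
    proof (intro suminf_le summableI)
      fix k
      have dL: "d k \<in> L2 lborel" unfolding d_def by (intro L2_diff f)
      have "(\<integral>\<^sup>+ x. ennreal (4^k * (norm (d k x))\<^sup>2) \<partial>lborel) = ennreal (LINT x|lborel. 4^k * (norm (d k x))\<^sup>2)"
        using L2_integrable[OF dL] by (intro nn_integral_eq_integral) auto
      also have "\<dots> = ennreal (4^k * (l2norm (d k))\<^sup>2)"
        by (simp add: l2norm_squared)
      also have "\<dots> \<le> ennreal (4^k * (1/8)^k)"
      proof (intro ennreal_leI mult_left_mono)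
        have "l2norm (d k) \<le> sqrt ((1/8)^k)"
          using r[of k "r (Suc k)" "r k"] rS[of k] unfolding d_def by simp
        then have "(l2norm (d k))\<^sup>2 \<le> (sqrt ((1/8)^k))\<^sup>2" by (intro power_mono) auto
        then show "(l2norm (d k))\<^sup>2 \<le> (1/8)^k" by simp
      qed simp
      also have "(4::real)^k * (1/8)^k = (1/2)^k" by (simp flip: power_mult_distrib)
      finally show "(\<integral>\<^sup>+ x. ennreal (4^k * (norm (d k x))\<^sup>2) \<partial>lborel) \<le> ennreal ((1/2)^k)" .
    qed
    also have "\<dots> = ennreal (\<Sum>k. (1/2)^k)"
      by (rule suminf_ennreal2) auto
    also have "\<dots> < \<infinity>" by simp
    finally show "(\<integral>\<^sup>+ x. (\<Sum>k. ennreal (4^k * (norm (d k x))\<^sup>2)) \<partial>lborel) \<noteq> \<infinity>"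
      by simp
  qed measurable
  then have conv: "AE x in lborel. convergent (\<lambda>k. f (r k) x)"
  proof eventually_elim
    case (elim x)
    then have "summable (\<lambda>k. 4^k * (norm (d k x))\<^sup>2)"
      by (intro summable_suminf_not_top) auto
    then have "Bseq (\<lambda>k. 4^k * (norm (d k x))\<^sup>2)"
      by (intro convergent_imp_Bseq) (auto simp: convergent_def dest: summable_LIMSEQ_zero)
    then obtain K where K: "K > 0" "\<And>k. norm (4^k * (norm (d k x))\<^sup>2) \<le> K" by (auto elim: BseqE)
    \<comment> \<open>The terms of the finite weighted sum are bounded, so the increments decay
      geometrically and their series converges absolutely.\<close>
    have "norm (d k x) \<le> sqrt K * (1/2)^k" for k
    proof -
      have "(2^k * norm (d k x))\<^sup>2 \<le> K"
        using K(2)[of k] by (simp add: power_mult_distrib power_mult[symmetric] mult.commute[of k])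
          (simp add: power_mult)
      then have "2^k * norm (d k x) \<le> sqrt K" by (rule real_le_rsqrt)
      then show ?thesis by (simp add: field_simps power_divide)
    qed
    then have "summable (\<lambda>k. d k x)"
      by (rule summable_comparison_test'[where g="\<lambda>k. sqrt K * (1/2)^k" and N=0, rotated])
        (auto intro!: summable_mult summable_geometric)
    then have "convergent (\<lambda>n. \<Sum>k<n. d k x)" by (simp add: summable_iff_convergent)
    moreover have "(\<lambda>n. \<Sum>k<n. d k x) = (\<lambda>n. f (r n) x - f (r 0) x)"
      using sum_lessThan_telescope[of "\<lambda>k. f (r k) x"] unfolding d_def by simp
    ultimately have "convergent (\<lambda>n. (f (r n) x - f (r 0) x) + f (r 0) x)"
      by (intro convergent_add convergent_const) auto
    then show ?case by simp
  qed
  define F where "F x = lim (\<lambda>k. f (r k) x)" for x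
  have [measurable]: "F \<in> borel_measurable lborel"
    unfolding F_def by (rule borel_measurable_lim_metric) measurable
  have lim: "AE x in lborel. (\<lambda>k. f (r k) x) \<longlonglongrightarrow> F x"
    using conv by eventually_elim (simp add: F_def convergent_LIMSEQ_iff)
  have fatou: "(\<integral>\<^sup>+ x. ennreal ((norm (f n x - F x))\<^sup>2) \<partial>lborel) \<le> ennreal (e\<^sup>2)"
    if e: "0 < e" and N: "\<And>m. m \<ge> N \<Longrightarrow> l2norm (\<lambda>x. f n x - f m x) < e" for n e N
  proof -
    have "(\<integral>\<^sup>+ x. ennreal ((norm (f n x - F x))\<^sup>2) \<partial>lborel)
        = (\<integral>\<^sup>+ x. liminf (\<lambda>k. ennreal ((norm (f n x - f (r k) x))\<^sup>2)) \<partial>lborel)"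
    proof (rule nn_integral_cong_AE)
      show "AE x in lborel. ennreal ((norm (f n x - F x))\<^sup>2) = liminf (\<lambda>k. ennreal ((norm (f n x - f (r k) x))\<^sup>2))"
        using lim
      proof eventually_elim
        case (elim x)
        have "(\<lambda>k. ennreal ((norm (f n x - f (r k) x))\<^sup>2)) \<longlonglongrightarrow> ennreal ((norm (f n x - F x))\<^sup>2)"
          by (intro tendsto_intros elim)
        then show ?case using lim_imp_Liminf[OF sequentially_bot] by metis
      qed
    qed
    also have "\<dots> \<le> liminf (\<lambda>k. \<integral>\<^sup>+ x. ennreal ((norm (f n x - f (r k) x))\<^sup>2) \<partial>lborel)"
      by (rule nn_integral_liminf) measurable
    also have "\<dots> \<le> ennreal (e\<^sup>2)"
    proof (rule Liminf_le)
      show "\<forall>\<^sub>F k in sequentially. (\<integral>\<^sup>+ x. ennreal ((norm (f n x - f (r k) x))\<^sup>2) \<partial>lborel) \<le> ennreal (e\<^sup>2)"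
        using eventually_ge_at_top[of N]
      proof eventually_elim
        case (elim k)
        have "N \<le> r k" using elim seq_suble[OF mono, of k] by simp
        then have less: "l2norm (\<lambda>x. f n x - f (r k) x) < e" by (rule N)
        have "(\<integral>\<^sup>+ x. ennreal ((norm (f n x - f (r k) x))\<^sup>2) \<partial>lborel) = ennreal ((l2norm (\<lambda>x. f n x - f (r k) x))\<^sup>2)"
          unfolding l2norm_squared
          by (intro nn_integral_eq_integral L2_integrable L2_diff f) auto
        also have "\<dots> \<le> ennreal (e\<^sup>2)"
          using less by (intro ennreal_leI power_mono) auto
        finally show ?case .
      qed
    qed simp
    finally show ?thesis .
  qed
  have FL: "(\<lambda>x. f n x - F x) \<in> L2 lborel \<and> l2norm (\<lambda>x. f n x - F x) \<le> e"
    if e: "0 < e" and N: "\<And>m. m \<ge> N \<Longrightarrow> l2norm (\<lambda>x. f n x - f m x) < e" for n e N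
  proof -
    have I: "integrable lborel (\<lambda>x. (norm (f n x - F x))\<^sup>2)"
      using le_less_trans[OF fatou[OF e N] ennreal_less_top] by (intro integrableI_bounded) auto
    then have "ennreal ((l2norm (\<lambda>x. f n x - F x))\<^sup>2) \<le> ennreal (e\<^sup>2)"
      unfolding l2norm_squared using fatou[OF e N] by (subst nn_integral_eq_integral[symmetric]) auto
    then have "(l2norm (\<lambda>x. f n x - F x))\<^sup>2 \<le> e\<^sup>2" by (simp add: ennreal_le_iff)
    then show ?thesis using I e by (auto simp: L2_def intro: power2_le_imp_le)
  qed
  obtain N where N: "\<forall>m\<ge>N. \<forall>n\<ge>N. l2norm (\<lambda>x. f m x - f n x) < 1"
    using Cauchy[of 1] by auto
  have "(\<lambda>x. f N x - F x) \<in> L2 lborel" using FL[of 1 N N] N by auto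
  from L2_diff[OF f[of N] this] have "F \<in> L2 lborel" by simp
  moreover have "(\<lambda>n. l2norm (\<lambda>x. f n x - F x)) \<longlonglongrightarrow> 0"
  proof (rule LIMSEQ_I)
    fix e :: real assume "0 < e"
    then obtain N where N: "\<forall>m\<ge>N. \<forall>n\<ge>N. l2norm (\<lambda>x. f m x - f n x) < e/2"
      using Cauchy[of "e/2"] by auto
    have "norm (l2norm (\<lambda>x. f n x - F x) - 0) < e" if "n \<ge> N" for n
      using FL[of "e/2" N n] N that \<open>0 < e\<close> by auto
    then show "\<exists>N. \<forall>n\<ge>N. norm (l2norm (\<lambda>x. f n x - F x) - 0) < e" by blast
  qed
  ultimately show ?thesis by blast
qed

section \<open>Orthonormal expansions and Riesz bases\<close>

lemma norm_vector_smult: "norm (c *s (x :: complex^'n)) = norm c * norm x"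
  by (simp add: norm_vec_def norm_mult L2_set_right_distrib)

lemma borel_measurable_vector_smult [measurable (raw)]:
  fixes f :: "real \<Rightarrow> complex^'n"
  assumes [measurable]: "f \<in> borel_measurable M"
  shows "(\<lambda>x. c *s f x) \<in> borel_measurable M"
proof -
  have "continuous_on UNIV (\<lambda>v :: complex^'n. c *s v)"
    unfolding vector_scalar_mult_def by (intro continuous_intros)
  then have "(\<lambda>v :: complex^'n. c *s v) \<in> borel_measurable borel" by (rule borel_measurable_continuous_onI)
  then show ?thesis by measurable
qed

lemma borel_measurable_vec_nth [measurable (raw)]:
  fixes f :: "real \<Rightarrow> complex^'n"
  assumes [measurable]: "f \<in> borel_measurable M"
  shows "(\<lambda>x. f x $ i) \<in> borel_measurable M"
proof -
  have "(\<lambda>v :: complex^'n. v $ i) \<in> borel_measurable borel"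
    by (intro borel_measurable_continuous_onI continuous_intros)
  then show ?thesis by measurable
qed

lemma L2_smult:
  fixes f :: "real \<Rightarrow> complex^'n"
  assumes "f \<in> L2 lborel"
  shows "(\<lambda>x. c *s f x) \<in> L2 lborel"
proof -
  note [measurable] = L2_measurable[OF assms]
  show ?thesis by (rule L2_dominated[OF assms, where C="norm c"]) (auto simp: norm_vector_smult)
qed

lemma L2_smult_sum:
  fixes e :: "'i \<Rightarrow> real \<Rightarrow> complex^'n"
  assumes "\<And>n. e n \<in> L2 lborel"
  shows "(\<lambda>x. \<Sum>n\<in>I. c n *s e n x) \<in> L2 lborel"
  by (intro L2_sum L2_smult assms)

lemma l2norm_smult: "l2norm (\<lambda>x. c *s f x) = norm c * l2norm (f :: real \<Rightarrow> complex^'n)"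
  by (simp add: l2norm_def norm_vector_smult power_mult_distrib real_sqrt_mult)

lemma L2_nth:
  fixes f :: "real \<Rightarrow> complex^'n"
  assumes "f \<in> L2 lborel"
  shows "(\<lambda>x. f x $ i) \<in> L2 lborel"
proof -
  note [measurable] = L2_measurable[OF assms]
  show ?thesis by (rule L2_dominated[OF assms, where C=1]) (auto simp: Finite_Cartesian_Product.norm_nth_le)
qed

lemma l2norm_nth_le:
  fixes f :: "real \<Rightarrow> complex^'n"
  assumes "f \<in> L2 lborel"
  shows "l2norm (\<lambda>x. f x $ i) \<le> l2norm f"
proof -
  note [measurable] = L2_measurable[OF assms]
  show ?thesis using l2norm_dominated[OF assms, where C=1 and g="\<lambda>x. f x $ i"] by (auto simp: Finite_Cartesian_Product.norm_nth_le)
qed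

lemma borel_measurable_cnj [measurable (raw)]:
  assumes [measurable]: "f \<in> borel_measurable M"
  shows "(\<lambda>x. cnj (f x)) \<in> borel_measurable M"
proof -
  have "cnj \<in> borel_measurable borel"
    by (intro borel_measurable_continuous_onI continuous_intros)
  then show ?thesis by measurable
qed

lemma L2_cnj:
  assumes "f \<in> L2 lborel" shows "(\<lambda>x. cnj (f x)) \<in> L2 lborel"
proof -
  note [measurable] = L2_measurable[OF assms]
  show ?thesis by (rule L2_dominated[OF assms, where C=1]) auto
qed

lemma l2inner_integrable:
  assumes "f \<in> L2 lborel" "g \<in> L2 lborel"
  shows "integrable lborel (\<lambda>x. \<Sum>i\<in>(UNIV :: 4 set). cnj (f x $ i) * g x $ i)"
  by (intro Bochner_Integration.integrable_sum L2_mult_integrable L2_cnj L2_nth assms)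

lemma l2inner_le:
  assumes f: "f \<in> L2 lborel" and g: "g \<in> L2 lborel"
  shows "norm (l2inner f g) \<le> l2norm f * l2norm g"
proof -
  have "norm (l2inner f g) \<le> (LINT x|lborel. norm (\<Sum>i\<in>(UNIV :: 4 set). cnj (f x $ i) * g x $ i))"
    unfolding l2inner_def by (rule integral_norm_bound)
  also have "\<dots> \<le> (LINT x|lborel. norm (f x) * norm (g x))"
  proof (rule integral_mono)
    show "integrable lborel (\<lambda>x. norm (\<Sum>i\<in>(UNIV :: 4 set). cnj (f x $ i) * g x $ i))"
      by (intro integrable_norm l2inner_integrable f g)
    show "integrable lborel (\<lambda>x. norm (f x) * norm (g x))"
      by (rule L2_norm_mult_integrable[OF f g])
    fix x
    have "norm (\<Sum>i\<in>(UNIV :: 4 set). cnj (f x $ i) * g x $ i) \<le> (\<Sum>i\<in>(UNIV :: 4 set). \<bar>norm (f x $ i)\<bar> * \<bar>norm (g x $ i)\<bar>)"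
      by (rule order_trans[OF norm_sum]) (simp add: norm_mult)
    also have "\<dots> \<le> norm (f x) * norm (g x)"
      unfolding norm_vec_def by (rule L2_set_mult_ineq)
    finally show "norm (\<Sum>i\<in>(UNIV :: 4 set). cnj (f x $ i) * g x $ i) \<le> norm (f x) * norm (g x)" .
  qed
  also have "\<dots> \<le> l2norm f * l2norm g" by (rule L2_Cauchy_Schwarz[OF f g])
  finally show ?thesis .
qed

lemma l2inner_add_right:
  assumes "h \<in> L2 lborel" "f \<in> L2 lborel" "g \<in> L2 lborel"
  shows "l2inner h (\<lambda>x. f x + g x) = l2inner h f + l2inner h g"
proof -
  have "l2inner h (\<lambda>x. f x + g x) = (LINT x|lborel. (\<Sum>i\<in>UNIV. cnj (h x $ i) * f x $ i) + (\<Sum>i\<in>UNIV. cnj (h x $ i) * g x $ i))"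
    unfolding l2inner_def by (simp add: distrib_left sum.distrib)
  also have "\<dots> = l2inner h f + l2inner h g"
    unfolding l2inner_def by (intro Bochner_Integration.integral_add l2inner_integrable assms)
  finally show ?thesis .
qed

lemma l2inner_smult_right: "l2inner h (\<lambda>x. c *s f x) = c * l2inner h f"
proof -
  have "l2inner h (\<lambda>x. c *s f x) = (LINT x|lborel. c * (\<Sum>i\<in>UNIV. cnj (h x $ i) * f x $ i))"
    unfolding l2inner_def by (simp add: sum_distrib_left mult_ac)
  then show ?thesis by (simp add: l2inner_def)
qed

lemma l2inner_diff_right:
  assumes "h \<in> L2 lborel" "f \<in> L2 lborel" "g \<in> L2 lborel"
  shows "l2inner h (\<lambda>x. f x - g x) = l2inner h f - l2inner h g"
  using l2inner_add_right[OF assms(1,2) L2_smult[OF assms(3), of "-1"]]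
    l2inner_smult_right[of h "-1" g] by simp

lemma l2inner_commute: "l2inner f g = cnj (l2inner g f)"
proof -
  have "cnj (l2inner g f) = (LINT x|lborel. cnj (\<Sum>i\<in>(UNIV :: 4 set). cnj (g x $ i) * f x $ i))"
    unfolding l2inner_def by (rule Bochner_Integration.integral_cnj[symmetric])
  then show ?thesis by (simp add: l2inner_def mult_ac)
qed

lemma l2inner_sum_right:
  assumes "h \<in> L2 lborel" "\<And>n. g n \<in> L2 lborel"
  shows "l2inner h (\<lambda>x. \<Sum>n\<in>I. a n *s g n x) = (\<Sum>n\<in>I. a n * l2inner h (g n))"
proof (induction I rule: infinite_finite_induct)
  case (insert n I)
  then show ?case
    by (simp add: l2inner_add_right[OF assms(1) L2_smult[OF assms(2)] L2_smult_sum[OF assms(2)]] l2inner_smult_right)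
qed (simp_all add: l2inner_def)

lemma l2inner_sum_left:
  assumes "h \<in> L2 lborel" "\<And>n. g n \<in> L2 lborel"
  shows "l2inner (\<lambda>x. \<Sum>n\<in>I. a n *s g n x) h = (\<Sum>n\<in>I. cnj (a n) * l2inner (g n) h)"
  unfolding l2inner_commute[of _ h] l2inner_sum_right[OF assms] by simp

lemma l2inner_self: "l2inner f f = of_real ((l2norm f)\<^sup>2)"
proof -
  have "(\<Sum>i\<in>UNIV. cnj (f x $ i) * f x $ i) = of_real ((norm (f x))\<^sup>2)" for x
    unfolding norm_vec_def L2_set_def
    by (simp add: sum_nonneg complex_norm_square mult.commute del: of_real_power)
  then have "l2inner f f = (LINT x|lborel. of_real ((norm (f x))\<^sup>2))"
    unfolding l2inner_def by simp
  then show ?thesis unfolding l2norm_squared by (simp only: integral_complex_of_real)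
qed

lemma l2norm_orthonormal_sum:
  assumes L: "\<And>n. g n \<in> L2 lborel"
    and o: "\<And>j k. l2inner (g j) (g k) = (if j = k then 1 else 0)" and "finite I"
  shows "(l2norm (\<lambda>x. \<Sum>n\<in>I. a n *s g n x))\<^sup>2 = (\<Sum>n\<in>I. (norm (a n))\<^sup>2)"
proof -
  have "of_real ((l2norm (\<lambda>x. \<Sum>n\<in>I. a n *s g n x))\<^sup>2) = (\<Sum>n\<in>I. cnj (a n) * (\<Sum>k\<in>I. a k * (if n = k then 1 else 0)))"
    unfolding l2inner_self[symmetric] l2inner_sum_left[OF L2_smult_sum[OF L] L] l2inner_sum_right[OF L L] o ..
  also have "\<dots> = (\<Sum>n\<in>I. of_real ((norm (a n))\<^sup>2))"
    using \<open>finite I\<close> by (intro sum.cong refl) (simp add: complex_norm_square mult.commute if_distrib sum.delta cong: if_cong del: of_real_power)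
  finally show ?thesis by (simp only: of_real_eq_iff flip: of_real_sum)
qed

text \<open>Totality only says that a function orthogonal to every \<open>g n\<close> vanishes. By
  Bessel's inequality the Fourier partial sums are Cauchy; completeness supplies a limit G, and
  totality applied to \<open>F - G\<close> identifies it with F.\<close>

lemma orthonormal_basis_expansion:
  assumes "orthonormal_basis g" and F: "F \<in> L2 lborel"
  shows "(\<lambda>N. l2norm (\<lambda>x. F x - (\<Sum>n<N. l2inner (g n) F *s g n x))) \<longlonglongrightarrow> 0"
proof -
  have L: "\<And>n. g n \<in> L2 lborel"
    and o: "\<And>j k. l2inner (g j) (g k) = (if j = k then 1 else 0)"
    and total: "\<And>f. f \<in> L2 lborel \<Longrightarrow> (\<And>n. l2inner (g n) f = 0) \<Longrightarrow> AE x in lborel. f x = 0"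
    using assms(1) by (auto simp: orthonormal_basis_def)
  define c where "c n = l2inner (g n) F" for n
  define s where "s N x = (\<Sum>n<N. c n *s g n x)" for N :: nat and x
  have sL: "s N \<in> L2 lborel" for N unfolding s_def by (rule L2_smult_sum[OF L])
  have bessel: "(\<Sum>n<N. (norm (c n))\<^sup>2) \<le> (l2norm F)\<^sup>2" for N
  proof -
    define S where "S = (\<Sum>n<N. (norm (c n))\<^sup>2)"
    have S: "(l2norm (s N))\<^sup>2 = S" unfolding s_def S_def by (rule l2norm_orthonormal_sum[OF L o]) simp
    have "l2inner (s N) F = (\<Sum>n<N. cnj (c n) * c n)"
      unfolding s_def l2inner_sum_left[OF F L] c_def ..
    also have "\<dots> = of_real S" by (simp add: S_def complex_norm_square mult.commute del: of_real_power)
    finally have "norm (complex_of_real S) \<le> l2norm (s N) * l2norm F"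
      using l2inner_le[OF sL F] by metis
    then have "l2norm (s N) * l2norm (s N) \<le> l2norm (s N) * l2norm F"
      using S by (simp add: power2_eq_square)
    then have "l2norm (s N) \<le> l2norm F"
      by (cases "l2norm (s N) = 0") (auto simp: less_le)
    then show ?thesis using S unfolding S_def[symmetric] by (metis l2norm_nonneg power_mono)
  qed
  have summ: "summable (\<lambda>n. (norm (c n))\<^sup>2)"
    by (rule bounded_imp_summable[where B="(l2norm F)\<^sup>2"]) (use bessel[of "Suc _"] in \<open>auto simp: lessThan_Suc_atMost\<close>)
  have "\<exists>G \<in> L2 lborel. (\<lambda>n. l2norm (\<lambda>x. s n x - G x)) \<longlonglongrightarrow> 0"
  proof (rule L2_complete[OF sL])
    fix e :: real assume e: "0 < e"
    then obtain N where N: "\<And>m n. m \<ge> N \<Longrightarrow> norm (\<Sum>k\<in>{m..<n}. (norm (c k))\<^sup>2) < e\<^sup>2"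
      using summ unfolding summable_Cauchy by (metis zero_less_power)
    have diff: "l2norm (\<lambda>x. s n x - s m x) < e" if "m \<ge> N" "m \<le> n" for m n
    proof -
      have "(\<lambda>x. s n x - s m x) = (\<lambda>x. \<Sum>k\<in>{m..<n}. c k *s g k x)"
      proof
        fix x
        show "s n x - s m x = (\<Sum>k\<in>{m..<n}. c k *s g k x)"
          using sum_diff_nat_ivl[of 0 m n "\<lambda>k. c k *s g k x"] \<open>m \<le> n\<close> by (simp add: s_def lessThan_atLeast0)
      qed
      then have "(l2norm (\<lambda>x. s n x - s m x))\<^sup>2 = (\<Sum>k\<in>{m..<n}. (norm (c k))\<^sup>2)"
        by (simp only: l2norm_orthonormal_sum[OF L o finite_atLeastLessThan])
      also have "\<dots> < e\<^sup>2" using N[OF that(1), of n] by simp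
      finally show ?thesis by (rule power2_less_imp_less) (use e in simp)
    qed
    show "\<exists>N. \<forall>m\<ge>N. \<forall>n\<ge>N. l2norm (\<lambda>x. s m x - s n x) < e"
    proof (intro exI allI impI)
      fix m n assume "m \<ge> N" "n \<ge> N"
      then show "l2norm (\<lambda>x. s m x - s n x) < e"
        using diff[of m n] diff[of n m] l2norm_minus_commute[of "s m" "s n"] by (cases "m \<le> n") auto
    qed
  qed
  then obtain G where G: "G \<in> L2 lborel" and lim: "(\<lambda>n. l2norm (\<lambda>x. s n x - G x)) \<longlonglongrightarrow> 0" by blast
  have "AE x in lborel. F x - G x = 0"
  proof (rule total[OF L2_diff[OF F G]])
    fix k
    have "norm (l2inner (g k) (\<lambda>x. F x - G x)) \<le> l2norm (g k) * l2norm (\<lambda>x. s N x - G x)" if "k < N" for N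
    proof -
      have "l2inner (g k) (s N) = c k"
        unfolding s_def l2inner_sum_right[OF L L] o using that by (simp add: if_distrib sum.delta cong: if_cong)
      then have "l2inner (g k) (\<lambda>x. F x - G x) = l2inner (g k) (\<lambda>x. s N x - G x)"
        by (simp add: l2inner_diff_right[OF L F G] l2inner_diff_right[OF L sL G] c_def)
      then show ?thesis using l2inner_le[OF L L2_diff[OF sL G]] by simp
    qed
    then have "norm (l2inner (g k) (\<lambda>x. F x - G x)) \<le> 0"
      by (intro tendsto_lowerbound[OF tendsto_mult_right_zero[OF lim]] eventually_mono[OF eventually_gt_at_top[of k]]) auto
    then show "l2inner (g k) (\<lambda>x. F x - G x) = 0" by simp
  qed
  then have ae: "AE x in lborel. F x = G x" by simp
  have "l2norm (\<lambda>x. F x - s N x) = l2norm (\<lambda>x. s N x - G x)" for N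
  proof -
    have "l2norm (\<lambda>x. s N x - F x) = l2norm (\<lambda>x. s N x - G x)"
      by (rule l2norm_cong_AE[OF L2_measurable[OF L2_diff[OF sL F]] L2_measurable[OF L2_diff[OF sL G]]])
        (use ae in auto)
    then show ?thesis by (simp add: l2norm_minus_commute)
  qed
  then show ?thesis using lim by (simp add: s_def c_def)
qed

section \<open>Transport of expansions by bounded operators\<close>

lemma bounded_operatorD:
  assumes "bounded_operator T"
  shows "f \<in> L2 lborel \<Longrightarrow> T f \<in> L2 lborel"
    and "f \<in> L2 lborel \<Longrightarrow> g \<in> L2 lborel \<Longrightarrow> AE x in lborel. T (\<lambda>y. f y + g y) x = T f x + T g x"
    and "f \<in> L2 lborel \<Longrightarrow> AE x in lborel. T (\<lambda>y. c *s f y) x = c *s T f x"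
    and "\<exists>C. \<forall>f \<in> L2 lborel. l2norm (T f) \<le> C * l2norm f"
  using assms unfolding bounded_operator_def by blast+

lemma bounded_operator_diff_sum:
  assumes T: "bounded_operator T" and f: "f \<in> L2 lborel" and g: "\<And>n. g n \<in> L2 lborel"
  shows "AE x in lborel. T (\<lambda>y. f y - (\<Sum>n<N. a n *s g n y)) x = T f x - (\<Sum>n<N::nat. a n *s T (g n) x)"
proof (induction N)
  case (Suc N)
  let ?h = "\<lambda>y. f y - (\<Sum>n<N. a n *s g n y)"
  have h: "?h \<in> L2 lborel" by (intro L2_diff f L2_smult_sum g)
  have "AE x in lborel. T (\<lambda>y. ?h y + (- a N) *s g N y) x = T ?h x + T (\<lambda>y. (- a N) *s g N y) x"
    by (rule bounded_operatorD(2)[OF T h L2_smult[OF g]])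
  moreover have "AE x in lborel. T (\<lambda>y. (- a N) *s g N y) x = (- a N) *s T (g N) x"
    by (rule bounded_operatorD(3)[OF T g])
  moreover note Suc
  ultimately have *: "AE x in lborel. T (\<lambda>y. ?h y + (- a N) *s g N y) x
      = T f x - (\<Sum>n<N. a n *s T (g n) x) + (- a N) *s T (g N) x"
    by eventually_elim simp
  have "(\<lambda>y. ?h y + (- a N) *s g N y) = (\<lambda>y. f y - (\<Sum>n<Suc N. a n *s g n y))"
    by (auto simp: algebra_simps)
  with * show ?case by (simp only:) (auto elim!: eventually_mono simp: algebra_simps)
qed simp

lemma bounded_operator_cong_AE:
  assumes T: "bounded_operator T" and f: "f \<in> L2 lborel" and g: "g \<in> L2 lborel"
    and "AE x in lborel. f x = g x"
  shows "AE x in lborel. T f x = T g x"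
proof -
  have d: "(\<lambda>y. f y - g y) \<in> L2 lborel" by (intro L2_diff f g)
  have Td: "T (\<lambda>y. f y - g y) \<in> L2 lborel" by (rule bounded_operatorD(1)[OF T d])
  have "l2norm (\<lambda>y. f y - g y) = 0"
    unfolding l2norm_eq_0[OF d] using assms(4) by simp
  moreover obtain C where "l2norm (T (\<lambda>y. f y - g y)) \<le> C * l2norm (\<lambda>y. f y - g y)"
    using bounded_operatorD(4)[OF T] d by blast
  ultimately have "l2norm (T (\<lambda>y. f y - g y)) = 0"
    using l2norm_nonneg[of "T (\<lambda>y. f y - g y)"] by auto
  then have "AE x in lborel. T (\<lambda>y. f y - g y) x = 0" unfolding l2norm_eq_0[OF Td] .
  moreover have "AE x in lborel. T (\<lambda>y. (f y - g y) + g y) x = T (\<lambda>y. f y - g y) x + T g x"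
    by (rule bounded_operatorD(2)[OF T d g])
  ultimately show ?thesis by eventually_elim simp
qed

text \<open>The remainders \<open>k N\<close> enter separately from \<open>T (h N)\<close> because
  linearity of T holds only almost everywhere: the image of a remainder is the transported remainder
  up to a null set.\<close>

lemma bounded_operator_tendsto_zero:
  assumes T: "bounded_operator T" and h: "\<And>N. h N \<in> L2 lborel" and k: "\<And>N. k N \<in> borel_measurable lborel"
    and lim: "(\<lambda>N. l2norm (h N)) \<longlonglongrightarrow> 0" and ae: "\<And>N. AE x in lborel. T (h N) x = k N x"
  shows "(\<lambda>N. l2norm (k N)) \<longlonglongrightarrow> 0"
proof -
  obtain C where C: "\<And>f. f \<in> L2 lborel \<Longrightarrow> l2norm (T f) \<le> C * l2norm f"
    using bounded_operatorD(4)[OF T] by blast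
  have "T (h N) \<in> borel_measurable lborel" for N
    by (rule L2_measurable[OF bounded_operatorD(1)[OF T h]])
  then have "l2norm (k N) \<le> C * l2norm (h N)" for N
    using l2norm_cong_AE[OF _ k ae, of N] C[OF h[of N]] by auto
  then show ?thesis
    by (intro tendsto_sandwich[OF _ _ tendsto_const[of 0] tendsto_mult_right_zero[OF lim, of C]]) auto
qed

text \<open>The coefficients of f are \<open>l2inner (g n) (S f)\<close>: T carries the orthonormal
  expansion of \<open>S f\<close> to an expansion of f. Conversely S carries any expansion of f back
  to one of \<open>S f\<close> along g, whose coefficients are determined by orthonormality.\<close>

lemma riesz_basis_imp_schauder_basis:
  assumes "riesz_basis e"
  shows "schauder_basis e"
proof -
  obtain g T S where e: "\<And>n. e n \<in> L2 lborel" and og: "orthonormal_basis g"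
    and T: "bounded_operator T" and S: "bounded_operator S"
    and ST: "\<And>f. f \<in> L2 lborel \<Longrightarrow> AE x in lborel. S (T f) x = f x"
    and TS: "\<And>f. f \<in> L2 lborel \<Longrightarrow> AE x in lborel. T (S f) x = f x"
    and eT: "\<And>n. AE x in lborel. e n x = T (g n) x"
    using assms unfolding riesz_basis_def by blast
  have g: "\<And>n. g n \<in> L2 lborel" and o: "\<And>j k. l2inner (g j) (g k) = (if j = k then 1 else 0)"
    using og by (auto simp: orthonormal_basis_def)
  have TL: "\<And>f. f \<in> L2 lborel \<Longrightarrow> T f \<in> L2 lborel" and SL: "\<And>f. f \<in> L2 lborel \<Longrightarrow> S f \<in> L2 lborel"
    using bounded_operatorD(1)[OF T] bounded_operatorD(1)[OF S] by blast+
  have Se: "AE x in lborel. S (e n) x = g n x" for n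
    using bounded_operator_cong_AE[OF S e TL[OF g] eT, of n] ST[OF g, of n] by eventually_elim simp
  have ex: "(\<lambda>N. l2norm (\<lambda>x. f x - (\<Sum>n<N. l2inner (g n) (S f) *s e n x))) \<longlonglongrightarrow> 0" if f: "f \<in> L2 lborel" for f
  proof (rule bounded_operator_tendsto_zero[OF T _ _ orthonormal_basis_expansion[OF og SL[OF f]]])
    fix N
    have "AE x in lborel. \<forall>n. e n x = T (g n) x" unfolding AE_all_countable using eT by blast
    then show "AE x in lborel. T (\<lambda>x. S f x - (\<Sum>n<N. l2inner (g n) (S f) *s g n x)) x
      = f x - (\<Sum>n<N. l2inner (g n) (S f) *s e n x)"
      using bounded_operator_diff_sum[OF T SL[OF f] g, where N=N and a="\<lambda>n. l2inner (g n) (S f)"] TS[OF f]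
      by eventually_elim simp
  qed (intro L2_measurable L2_diff L2_smult_sum SL f g e)+
  have uniq: "c k = l2inner (g k) (S f)"
    if f: "f \<in> L2 lborel" and lim: "(\<lambda>N. l2norm (\<lambda>x. f x - (\<Sum>n<N. c n *s e n x))) \<longlonglongrightarrow> 0" for f c k
  proof -
    have lim': "(\<lambda>N. l2norm (\<lambda>x. S f x - (\<Sum>n<N. c n *s g n x))) \<longlonglongrightarrow> 0"
    proof (rule bounded_operator_tendsto_zero[OF S _ _ lim])
      fix N
      have "AE x in lborel. \<forall>n. S (e n) x = g n x" unfolding AE_all_countable using Se by blast
      then show "AE x in lborel. S (\<lambda>x. f x - (\<Sum>n<N. c n *s e n x)) x = S f x - (\<Sum>n<N. c n *s g n x)"
        using bounded_operator_diff_sum[OF S f e, where N=N and a=c] by eventually_elim simp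
    qed (intro L2_measurable L2_diff L2_smult_sum SL f g e)+
    have "norm (l2inner (g k) (S f) - c k) \<le> l2norm (g k) * l2norm (\<lambda>x. S f x - (\<Sum>n<N. c n *s g n x))"
      if "k < N" for N
    proof -
      have "l2inner (g k) (\<lambda>x. S f x - (\<Sum>n<N. c n *s g n x)) = l2inner (g k) (S f) - c k"
        unfolding l2inner_diff_right[OF g SL[OF f] L2_smult_sum[OF g]] l2inner_sum_right[OF g g] o
        using that by (simp add: if_distrib sum.delta cong: if_cong)
      then show ?thesis
        using l2inner_le[OF g[of k] L2_diff[OF SL[OF f] L2_smult_sum[where e=g and c=c and I="{..<N}", OF g]]] by simp
    qed
    then have "norm (l2inner (g k) (S f) - c k) \<le> 0"
      by (intro tendsto_lowerbound[OF tendsto_mult_right_zero[OF lim']] eventually_mono[OF eventually_gt_at_top[of k]]) auto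
    then show ?thesis by simp
  qed
  show ?thesis unfolding schauder_basis_def
  proof (intro conjI allI ballI)
    fix f :: "real \<Rightarrow> complex^4" assume f: "f \<in> L2 lborel"
    show "\<exists>!c. (\<lambda>N. l2norm (\<lambda>x. f x - (\<Sum>n<N. c n *s e n x))) \<longlonglongrightarrow> 0"
      by (rule ex1I[of _ "\<lambda>n. l2inner (g n) (S f)"]) (rule ex[OF f], rule ext, rule uniq[OF f])
  qed (rule e)
qed

section \<open>Smooth cutoffs and weak derivatives\<close>

definition smooth :: "(real \<Rightarrow> real) \<Rightarrow> bool" where
  "smooth f \<longleftrightarrow> (\<forall>k x. (deriv ^^ k) f differentiable (at x))"

text \<open>A class of differentiable functions closed under differentiation consists of smooth
  functions. Closure properties can thus be proved by exhibiting an invariant class, without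
  formulas for higher derivatives.\<close>

lemma smooth_coinduct:
  assumes "P f" and step: "\<And>g. P g \<Longrightarrow> (\<forall>x. g differentiable (at x)) \<and> P (deriv g)"
  shows "smooth f"
proof -
  have "P ((deriv ^^ k) f)" for k by (induction k) (use assms in auto)
  then show ?thesis using step by (auto simp: smooth_def)
qed

lemma smooth_differentiable: "smooth f \<Longrightarrow> f differentiable (at x)"
  unfolding smooth_def by (metis funpow_0)

lemma smooth_DERIV: "smooth f \<Longrightarrow> (f has_real_derivative deriv f x) (at x)"
  using smooth_differentiable[of f x] by (simp add: DERIV_deriv_iff_real_differentiable)

lemma smooth_deriv: "smooth f \<Longrightarrow> smooth (deriv f)"
  unfolding smooth_def by (metis comp_apply funpow_Suc_right)

lemma smooth_continuous: "smooth f \<Longrightarrow> continuous_on A f"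
  using smooth_DERIV[of f] by (meson DERIV_isCont continuous_at_imp_continuous_on)

text \<open>By the Leibniz rule products alone are not closed under differentiation, but sums of
  products are; this is the invariant class for \<open>smooth_mult\<close>.\<close>

inductive sum_of_smooth_products :: "(real \<Rightarrow> real) \<Rightarrow> bool" where
  "smooth f \<Longrightarrow> smooth g \<Longrightarrow> sum_of_smooth_products (\<lambda>x. f x * g x)"
| "sum_of_smooth_products f \<Longrightarrow> sum_of_smooth_products g \<Longrightarrow> sum_of_smooth_products (\<lambda>x. f x + g x)"

lemma sum_of_smooth_products_DERIV:
  "sum_of_smooth_products h \<Longrightarrow> \<exists>h'. (\<forall>x. (h has_real_derivative h' x) (at x)) \<and> sum_of_smooth_products h'"
proof (induction rule: sum_of_smooth_products.induct)
  case (1 f g)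
  then show ?case
    by (intro exI[of _ "\<lambda>x. deriv f x * g x + f x * deriv g x"] conjI allI sum_of_smooth_products.intros)
      (auto intro!: derivative_eq_intros smooth_DERIV smooth_deriv)
next
  case (2 f g)
  then obtain f' g' where "\<forall>x. (f has_real_derivative f' x) (at x)" "sum_of_smooth_products f'"
    "\<forall>x. (g has_real_derivative g' x) (at x)" "sum_of_smooth_products g'" by blast
  then show ?case
    by (intro exI[of _ "\<lambda>x. f' x + g' x"] conjI allI sum_of_smooth_products.intros DERIV_add) auto
qed

lemma smooth_coinduct_DERIV:
  assumes "P f" and step: "\<And>g. P g \<Longrightarrow> \<exists>g'. (\<forall>x. (g has_real_derivative g' x) (at x)) \<and> P g'"
  shows "smooth f"
proof (rule smooth_coinduct[of P, OF assms(1)])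
  fix g assume "P g"
  then obtain g' where g': "\<forall>x. (g has_real_derivative g' x) (at x)" "P g'" using step by blast
  then have "deriv g = g'" by (auto intro: DERIV_imp_deriv)
  then show "(\<forall>x. g differentiable (at x)) \<and> P (deriv g)"
    using g' real_differentiable_def by auto
qed

lemma smooth_mult: "smooth f \<Longrightarrow> smooth g \<Longrightarrow> smooth (\<lambda>x. f x * g x)"
  by (rule smooth_coinduct_DERIV[of sum_of_smooth_products])
    (auto intro: sum_of_smooth_products.intros sum_of_smooth_products_DERIV)

lemma smooth_affine:
  assumes "smooth f"
  shows "smooth (\<lambda>x. c * f (a * x + b))"
\<comment> \<open>The scalar c must vary in the invariant, since each differentiation contributes a
  factor a.\<close>
proof (rule smooth_coinduct_DERIV[of "\<lambda>h. \<exists>c f. smooth f \<and> h = (\<lambda>x. c * f (a * x + b))"])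
  fix g assume "\<exists>c f. smooth f \<and> g = (\<lambda>x. c * f (a * x + b))"
  then obtain c f where f: "smooth f" "g = (\<lambda>x. c * f (a * x + b))" by blast
  have "(g has_real_derivative (c * a) * deriv f (a * x + b)) (at x)" for x
  proof -
    have "((\<lambda>x. f (a * x + b)) has_real_derivative deriv f (a * x + b) * a) (at x)"
      by (rule DERIV_chain2[OF smooth_DERIV[OF f(1)]]) (auto intro!: derivative_eq_intros)
    from DERIV_cmult[OF this, of c] show ?thesis by (simp add: f(2) mult_ac)
  qed
  then show "\<exists>g'. (\<forall>x. (g has_real_derivative g' x) (at x)) \<and> (\<exists>c f. smooth f \<and> g' = (\<lambda>x. c * f (a * x + b)))"
    using smooth_deriv[OF f(1)] by (intro exI[of _ "\<lambda>x. (c * a) * deriv f (a * x + b)"]) auto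
qed (use assms in blast)

section \<open>A flat function and a smooth cutoff\<close>

definition flat :: "real poly \<Rightarrow> real \<Rightarrow> real" where
  "flat p x = (if x > 0 then poly p (1 / x) * exp (- (1 / x)) else 0)"

lemma poly_mult_exp_minus_tendsto_0: "((\<lambda>x::real. poly p x * exp (- x)) \<longlongrightarrow> 0) at_top"
proof -
  have "((\<lambda>x::real. \<Sum>i\<le>degree p. coeff p i * (x ^ i / exp x)) \<longlongrightarrow> (\<Sum>i\<le>degree p. coeff p i * 0)) at_top"
    by (intro tendsto_intros tendsto_power_div_exp_0)
  then show ?thesis by (simp add: poly_altdef exp_minus sum_distrib_right divide_inverse mult.assoc)
qed

text \<open>With y = 1/x the derivative in x is -y^2 times the derivative in y, which sends p(y)
  exp(-y) to y^2 (p - p')(y) exp(-y). Carrying the polynomial as a parameter thus makes the family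
  closed under differentiation, including at the origin.\<close>

lemma flat_DERIV: "(flat p has_real_derivative flat (monom 1 2 * (p - pderiv p)) x) (at x)"
proof (cases x "0 :: real" rule: linorder_cases)
  case less
  have "((\<lambda>x. 0) has_real_derivative 0) (at x)" by simp
  then have "(flat p has_real_derivative 0) (at x)"
    by (rule has_field_derivative_transform_within_open[where S="{..<0}"]) (use less in \<open>auto simp: flat_def\<close>)
  then show ?thesis using less by (simp add: flat_def)
next
  case greater
  have "((\<lambda>x. poly p (1 / x) * exp (- (1 / x))) has_real_derivative
      flat (monom 1 2 * (p - pderiv p)) x) (at x)"
    using greater by (auto intro!: derivative_eq_intros DERIV_chain2[OF poly_DERIV]
        simp: flat_def poly_monom field_simps power2_eq_square)
  then show ?thesis
    by (rule has_field_derivative_transform_within_open[where S="{0<..}"]) (use greater in \<open>auto simp: flat_def\<close>)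
next
  case equal
  have "((\<lambda>h. flat p h / h) \<longlongrightarrow> 0) (at 0)"
  proof (rule filterlim_split_at)
    show "((\<lambda>h. flat p h / h) \<longlongrightarrow> 0) (at_left 0)"
      by (rule tendsto_eventually) (auto simp: flat_def eventually_at_filter)
    \<comment> \<open>Dividing by h multiplies by y = 1/h, which is the shift
      \<open>pCons 0 p\<close>; the exponential still wins.\<close>
    have "((\<lambda>h. poly (pCons 0 p) (inverse h) * exp (- inverse h)) \<longlongrightarrow> 0) (at_right (0::real))"
      by (rule filterlim_compose[OF poly_mult_exp_minus_tendsto_0 filterlim_inverse_at_top_right])
    then show "((\<lambda>h. flat p h / h) \<longlongrightarrow> 0) (at_right 0)"
      by (rule Lim_transform_eventually)
        (auto simp: flat_def eventually_at_filter divide_inverse mult_ac)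
  qed
  then show ?thesis using equal by (simp add: DERIV_def flat_def)
qed

lemma smooth_flat: "smooth (flat p)"
  by (rule smooth_coinduct_DERIV[of "\<lambda>f. \<exists>p. f = flat p"]) (use flat_DERIV in blast)+

lemma smooth_cutoff:
  obtains \<eta> C where "smooth \<eta>" "\<eta> 0 = 1" "\<And>x. \<bar>x\<bar> > 1 \<Longrightarrow> \<eta> x = 0"
    "\<And>x. \<bar>\<eta> x\<bar> \<le> C" "\<And>x. \<bar>deriv \<eta> x\<bar> \<le> C"
proof -
  \<comment> \<open>A product of exp(-1/(1+x)) and exp(-1/(1-x)), one factor vanishing on each side
    of the interval; at 0 it is exp(-2), hence the normalization \<open>exp 2\<close>. The
    spelled-out units match \<open>smooth_affine\<close>.\<close>
  define \<eta> where "\<eta> x = (exp 2 * flat 1 (1 * x + 1)) * (1 * flat 1 ((-1) * x + 1))" for x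
  have smooth: "smooth \<eta>" unfolding \<eta>_def by (intro smooth_mult smooth_affine smooth_flat)
  have supp: "\<eta> x = 0" if "\<bar>x\<bar> > 1" for x using that by (auto simp: \<eta>_def flat_def)
  have one: "\<eta> 0 = 1" by (simp add: \<eta>_def flat_def flip: exp_add)
  have supp': "deriv \<eta> x = 0" if "\<bar>x\<bar> > 1" for x
  proof (rule DERIV_imp_deriv)
    have "((\<lambda>x. 0) has_real_derivative 0) (at x)" by simp
    then show "(\<eta> has_real_derivative 0) (at x)"
      by (rule has_field_derivative_transform_within_open[where S="{x. \<bar>x\<bar> > 1}"])
        (use that in \<open>auto simp: supp intro!: open_Collect_less continuous_intros\<close>)
  qed
  have bdd: "\<exists>C. \<forall>x. \<bar>f x\<bar> \<le> C" if "smooth f" "\<And>x. \<bar>x\<bar> > 1 \<Longrightarrow> f x = 0" for f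
  proof -
    have "compact (f ` {-1..1})" by (intro compact_continuous_image smooth_continuous that) auto
    then obtain C where C: "\<And>y. y \<in> f ` {-1..1} \<Longrightarrow> norm y \<le> C"
      using compact_imp_bounded bounded_iff by metis
    have "\<bar>f x\<bar> \<le> max C 0" for x
    proof (cases "\<bar>x\<bar> > 1")
      case False
      then have "x \<in> {-1..1}" by auto
      then have "\<bar>f x\<bar> \<le> C" using C[OF imageI, of x] by simp
      then show ?thesis by simp
    qed (use that(2)[of x] in simp)
    then show ?thesis by blast
  qed
  obtain C1 C2 where "\<And>x. \<bar>\<eta> x\<bar> \<le> C1" "\<And>x. \<bar>deriv \<eta> x\<bar> \<le> C2"
    using bdd[OF smooth supp] bdd[OF smooth_deriv[OF smooth] supp'] by blast
  then show ?thesis by (intro that[OF smooth one supp, of "max C1 C2"]) (auto simp: le_max_iff_disj)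
qed

text \<open>Extends the defining identity to test functions without compact support: multiply \<phi>
  by cutoffs \<open>\<eta> (a n * x)\<close> that widen as \<open>a n\<close> tends to 0, and pass
  to the limit by dominated convergence.\<close>

lemma has_weak_deriv_smooth_L2:
  assumes wd: "has_weak_deriv f g" and f: "f \<in> L2 lborel" and g: "g \<in> L2 lborel"
    and \<phi>: "smooth \<phi>" "\<phi> \<in> L2 lborel" "deriv \<phi> \<in> L2 lborel"
  shows "(LINT x|lborel. of_real (deriv \<phi> x) * f x) = - (LINT x|lborel. of_real (\<phi> x) * g x)"
proof -
  obtain \<eta> C where \<eta>: "smooth \<eta>" "\<eta> 0 = 1" "\<And>x. \<bar>x\<bar> > 1 \<Longrightarrow> \<eta> x = 0"
    "\<And>x. \<bar>\<eta> x\<bar> \<le> C" "\<And>x. \<bar>deriv \<eta> x\<bar> \<le> C" by (rule smooth_cutoff) blast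
  have C: "0 \<le> C" using \<eta>(4)[of 0] by linarith
  note [measurable] = L2_measurable[OF f] L2_measurable[OF g] L2_measurable[OF \<phi>(2)] L2_measurable[OF \<phi>(3)]
  have [measurable]: "\<eta> \<in> borel_measurable borel" "deriv \<eta> \<in> borel_measurable borel"
    by (intro borel_measurable_continuous_onI smooth_continuous smooth_deriv \<eta>)+
  define a where "a n = 1 / real (Suc n)" for n
  have a: "0 < a n" "a n \<le> 1" for n by (auto simp: a_def)
  have a0: "a \<longlonglongrightarrow> 0" unfolding a_def using LIMSEQ_inverse_real_of_nat by (simp add: divide_inverse)
  define \<phi>n where "\<phi>n n x = (1 * \<eta> (a n * x + 0)) * \<phi> x" for n x
  have smooth: "smooth (\<phi>n n)" for n unfolding \<phi>n_def by (intro smooth_mult smooth_affine \<eta> \<phi>)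
  have der: "deriv (\<phi>n n) x = a n * deriv \<eta> (a n * x) * \<phi> x + \<eta> (a n * x) * deriv \<phi> x" for n x
  proof (rule DERIV_imp_deriv)
    have "((\<lambda>x. \<eta> (a n * x + 0)) has_real_derivative deriv \<eta> (a n * x + 0) * a n) (at x)"
      by (rule DERIV_chain2[OF smooth_DERIV[OF \<eta>(1)]]) (auto intro!: derivative_eq_intros)
    from DERIV_mult[OF this smooth_DERIV[OF \<phi>(1), of x]]
    show "(\<phi>n n has_real_derivative a n * deriv \<eta> (a n * x) * \<phi> x + \<eta> (a n * x) * deriv \<phi> x) (at x)"
      unfolding \<phi>n_def[abs_def] by (simp add: mult_ac add_ac)
  qed
  have test: "test_function (\<phi>n n)" for n
    unfolding test_function_def
  proof
    have "{x. \<phi>n n x \<noteq> 0} \<subseteq> {- 1 / a n..1 / a n}"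
    proof
      fix x assume "x \<in> {x. \<phi>n n x \<noteq> 0}"
      then have "\<not> 1 < \<bar>a n * x\<bar>" using \<eta>(3)[of "a n * x"] by (auto simp: \<phi>n_def)
      then have "\<bar>x\<bar> \<le> 1 / a n" using a(1)[of n] by (simp add: abs_mult field_simps)
      then show "x \<in> {- 1 / a n..1 / a n}" by auto
    qed
    then show "compact (closure {x. \<phi>n n x \<noteq> 0})"
      unfolding compact_closure using bounded_closed_interval bounded_subset by blast
  qed (use smooth[of n] in \<open>simp add: smooth_def\<close>)
  have cont0: "(\<lambda>n. h (a n * x)) \<longlonglongrightarrow> h 0" if "smooth h" for h x
  proof -
    have "isCont h 0" using smooth_DERIV[OF that] by (rule DERIV_isCont)
    moreover have "(\<lambda>n. a n * x) \<longlonglongrightarrow> 0" using tendsto_mult_left_zero[OF a0, of x] .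
    ultimately show ?thesis by (rule isCont_tendsto_compose)
  qed
  \<comment> \<open>The term in which the cutoff is differentiated carries the factor
    \<open>a n\<close>: it is dominated because \<open>a n \<le> 1\<close> and disappears in the
    limit.\<close>
  have L: "(\<lambda>n. LINT x|lborel. of_real (deriv (\<phi>n n) x) * f x) \<longlonglongrightarrow> (LINT x|lborel. of_real (deriv \<phi> x) * f x)"
  proof (rule integral_dominated_convergence[where w="\<lambda>x. C * (norm (\<phi> x) * norm (f x)) + C * (norm (deriv \<phi> x) * norm (f x))"])
    show "integrable lborel (\<lambda>x. C * (norm (\<phi> x) * norm (f x)) + C * (norm (deriv \<phi> x) * norm (f x)))"
      by (intro Bochner_Integration.integrable_add integrable_mult_right L2_norm_mult_integrable f \<phi>)
    show "AE x in lborel. (\<lambda>n. of_real (deriv (\<phi>n n) x) * f x) \<longlonglongrightarrow> of_real (deriv \<phi> x) * f x"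
    proof (rule AE_I2)
      fix x
      have "(\<lambda>n. a n * deriv \<eta> (a n * x) * \<phi> x + \<eta> (a n * x) * deriv \<phi> x)
         \<longlonglongrightarrow> 0 * deriv \<eta> 0 * \<phi> x + \<eta> 0 * deriv \<phi> x"
        by (intro tendsto_intros a0 cont0 smooth_deriv \<eta>)
      then show "(\<lambda>n. of_real (deriv (\<phi>n n) x) * f x) \<longlonglongrightarrow> of_real (deriv \<phi> x) * f x"
        unfolding der using \<eta>(2) by (intro tendsto_intros) simp
    qed
    show "AE x in lborel. norm (of_real (deriv (\<phi>n n) x) * f x) \<le> C * (norm (\<phi> x) * norm (f x)) + C * (norm (deriv \<phi> x) * norm (f x))" for n
    proof (rule AE_I2)
      fix x
      have "\<bar>deriv (\<phi>n n) x\<bar> \<le> \<bar>a n\<bar> * \<bar>deriv \<eta> (a n * x)\<bar> * \<bar>\<phi> x\<bar> + \<bar>\<eta> (a n * x)\<bar> * \<bar>deriv \<phi> x\<bar>"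
        unfolding der by (rule order_trans[OF abs_triangle_ineq]) (simp add: abs_mult)
      also have "\<dots> \<le> 1 * C * \<bar>\<phi> x\<bar> + C * \<bar>deriv \<phi> x\<bar>"
        using a[of n] C by (intro add_mono mult_mono \<eta>) auto
      finally have "\<bar>deriv (\<phi>n n) x\<bar> * norm (f x) \<le> (1 * C * \<bar>\<phi> x\<bar> + C * \<bar>deriv \<phi> x\<bar>) * norm (f x)"
        by (intro mult_right_mono) auto
      then show "norm (of_real (deriv (\<phi>n n) x) * f x) \<le> C * (norm (\<phi> x) * norm (f x)) + C * (norm (deriv \<phi> x) * norm (f x))"
        by (simp add: norm_mult algebra_simps)
    qed
  qed (unfold der, measurable)
  have R: "(\<lambda>n. LINT x|lborel. of_real (\<phi>n n x) * g x) \<longlonglongrightarrow> (LINT x|lborel. of_real (\<phi> x) * g x)"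
  proof (rule integral_dominated_convergence[where w="\<lambda>x. C * (norm (\<phi> x) * norm (g x))"])
    show "integrable lborel (\<lambda>x. C * (norm (\<phi> x) * norm (g x)))"
      by (intro integrable_mult_right L2_norm_mult_integrable g \<phi>)
    show "AE x in lborel. (\<lambda>n. of_real (\<phi>n n x) * g x) \<longlonglongrightarrow> of_real (\<phi> x) * g x"
    proof (rule AE_I2)
      fix x
      have "(\<lambda>n. (1 * \<eta> (a n * x)) * \<phi> x) \<longlonglongrightarrow> (1 * \<eta> 0) * \<phi> x"
        by (intro tendsto_intros cont0 \<eta>)
      then show "(\<lambda>n. of_real (\<phi>n n x) * g x) \<longlonglongrightarrow> of_real (\<phi> x) * g x"
        unfolding \<phi>n_def using \<eta>(2) by (intro tendsto_intros) simp
    qed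
    show "AE x in lborel. norm (of_real (\<phi>n n x) * g x) \<le> C * (norm (\<phi> x) * norm (g x))" for n
      unfolding \<phi>n_def using \<eta>(4) by (intro AE_I2) (auto simp: norm_mult abs_mult mult.assoc intro!: mult_right_mono)
  qed (unfold \<phi>n_def, measurable)
  have "(LINT x|lborel. of_real (deriv (\<phi>n n) x) * f x) = - (LINT x|lborel. of_real (\<phi>n n x) * g x)" for n
    using wd test[of n] by (auto simp: has_weak_deriv_def)
  with L have "(\<lambda>n. - (LINT x|lborel. of_real (\<phi>n n x) * g x)) \<longlonglongrightarrow> (LINT x|lborel. of_real (deriv \<phi> x) * f x)"
    by simp
  then show ?thesis using tendsto_minus[OF R] LIMSEQ_unique by blast
qed

section \<open>Polynomials times Gaussians\<close>

definition gauss :: "complex \<Rightarrow> complex poly \<Rightarrow> real \<Rightarrow> complex" where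
  "gauss \<beta> p x = poly p (of_real x) * exp (- \<beta> * (of_real x)\<^sup>2 / 2)"

text \<open>The derivative d/dx conjugated by the Gaussian, acting on the polynomial factor.\<close>

definition gauss_deriv :: "complex \<Rightarrow> complex poly \<Rightarrow> complex poly" where
  "gauss_deriv \<beta> p = pderiv p - [:0, \<beta>:] * p"

lemma gauss_add: "gauss \<beta> (p + q) x = gauss \<beta> p x + gauss \<beta> q x"
  by (simp add: gauss_def distrib_right)

lemma gauss_diff: "gauss \<beta> (p - q) x = gauss \<beta> p x - gauss \<beta> q x"
  by (simp add: gauss_def left_diff_distrib)

lemma gauss_smult: "gauss \<beta> (smult c p) x = c * gauss \<beta> p x"
  by (simp add: gauss_def)

lemma gauss_monomial: "gauss \<beta> ([:0, c:] * p) x = c * of_real x * gauss \<beta> p x"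
  by (simp add: gauss_def mult_ac)

lemma gauss_mult: "gauss \<beta> p x * gauss \<gamma> q x = gauss (\<beta> + \<gamma>) (p * q) x"
proof -
  have "exp (- \<beta> * (of_real x)\<^sup>2 / 2) * exp (- \<gamma> * (of_real x)\<^sup>2 / 2) = exp (- (\<beta> + \<gamma>) * (complex_of_real x)\<^sup>2 / 2)"
    unfolding exp_add[symmetric] by (simp add: field_simps)
  then show ?thesis by (simp add: gauss_def mult_ac)
qed

lemma gauss_has_vector_derivative:
  "(gauss \<beta> p has_vector_derivative gauss \<beta> (gauss_deriv \<beta> p) x) (at x)"
proof -
  have "((\<lambda>z. poly p z * exp (- \<beta> * z\<^sup>2 / 2)) has_field_derivative
      gauss \<beta> (gauss_deriv \<beta> p) x) (at (of_real x))"
    unfolding gauss_def gauss_deriv_def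
    by (auto intro!: derivative_eq_intros poly_DERIV simp: algebra_simps)
  from has_vector_derivative_real_field[OF this] show ?thesis
    unfolding gauss_def[abs_def] by simp
qed

lemma gauss_isCont: "isCont (gauss \<beta> p) x"
  using gauss_has_vector_derivative by (rule has_vector_derivative_continuous)

lemma gauss_measurable [measurable]: "gauss \<beta> p \<in> borel_measurable borel"
  by (intro borel_measurable_continuous_onI continuous_at_imp_continuous_on) (simp add: gauss_isCont)

lemma Re_gauss_DERIV: "((\<lambda>x. Re (gauss \<beta> p x)) has_real_derivative Re (gauss \<beta> (gauss_deriv \<beta> p) x)) (at x)"
  unfolding has_real_derivative_iff_has_vector_derivative
  by (rule bounded_linear.has_vector_derivative[OF bounded_linear_Re gauss_has_vector_derivative])

lemma smooth_Re_gauss: "smooth (\<lambda>x. Re (gauss \<beta> p x))"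
proof (rule smooth_coinduct_DERIV[of "\<lambda>f. \<exists>p. f = (\<lambda>x. Re (gauss \<beta> p x))"])
  fix g assume "\<exists>p. g = (\<lambda>x. Re (gauss \<beta> p x))"
  then obtain p where "g = (\<lambda>x. Re (gauss \<beta> p x))" by blast
  then show "\<exists>g'. (\<forall>x. (g has_real_derivative g' x) (at x)) \<and> (\<exists>p. g' = (\<lambda>x. Re (gauss \<beta> p x)))"
    using Re_gauss_DERIV[of \<beta> p] by (intro exI[of _ "\<lambda>x. Re (gauss \<beta> (gauss_deriv \<beta> p) x)"]) auto
qed blast

text \<open>A crude exponential rate is enough, since a Gaussian absorbs any exp(K|x|), and it makes
  the induction on the coefficients immediate.\<close>

lemma poly_le_exp: "\<exists>C K. 0 \<le> C \<and> 0 \<le> K \<and> (\<forall>x::real. norm (poly p (of_real x) :: complex) \<le> C * exp (K * \<bar>x\<bar>))"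
proof (induction p)
  case 0
  show ?case by (intro exI[of _ 0]) simp
next
  case (pCons a p)
  then obtain C K where CK: "0 \<le> C" "0 \<le> K" "\<And>x::real. norm (poly p (of_real x)) \<le> C * exp (K * \<bar>x\<bar>)" by blast
  have "norm (poly (pCons a p) (of_real x)) \<le> (norm a + C) * exp ((K + 1) * \<bar>x\<bar>)" for x :: real
  proof -
    have e: "\<bar>x\<bar> \<le> exp \<bar>x\<bar>" using exp_ge_add_one_self[of "\<bar>x\<bar>"] by linarith
    have "norm (poly (pCons a p) (of_real x)) \<le> norm a + \<bar>x\<bar> * norm (poly p (of_real x))"
      by (simp add: norm_triangle_le norm_mult)
    also have "\<dots> \<le> norm a * exp ((K + 1) * \<bar>x\<bar>) + exp \<bar>x\<bar> * (C * exp (K * \<bar>x\<bar>))"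
    proof (intro add_mono mult_mono CK e)
      have "norm a * 1 \<le> norm a * exp ((K + 1) * \<bar>x\<bar>)" using CK by (intro mult_left_mono) auto
      then show "norm a \<le> norm a * exp ((K + 1) * \<bar>x\<bar>)" by simp
    qed auto
    also have "\<dots> = (norm a + C) * exp ((K + 1) * \<bar>x\<bar>)" by (simp add: algebra_simps exp_add)
    finally show ?thesis .
  qed
  then show ?case using CK by (intro exI[of _ "norm a + C"] exI[of _ "K + 1"]) auto
qed

text \<open>Half of the Gaussian decay is spent on absorbing the polynomial and exp(L|x|). The free
  rate L later provides the exponential moments needed for moment determinacy.\<close>

lemma gauss_bound:
  assumes "0 < Re \<beta>"
  shows "\<exists>C. 0 \<le> C \<and> (\<forall>x. norm (gauss \<beta> p x) * exp (L * \<bar>x\<bar>) \<le> C * exp (- (Re \<beta> / 4) * x\<^sup>2))"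
proof -
  obtain C K where CK: "0 \<le> C" "0 \<le> K" "\<And>x::real. norm (poly p (of_real x)) \<le> C * exp (K * \<bar>x\<bar>)"
    using poly_le_exp by blast
  \<comment> \<open>The maximum over y of (K + L) y - (Re \<beta> / 4) y^2.\<close>
  define M where "M = (K + L)\<^sup>2 / Re \<beta>"
  have "norm (gauss \<beta> p x) * exp (L * \<bar>x\<bar>) \<le> (C * exp M) * exp (- (Re \<beta> / 4) * x\<^sup>2)" for x
  proof -
    have "(K + L) * \<bar>x\<bar> \<le> M + Re \<beta> / 4 * x\<^sup>2"
    proof -
      have "0 \<le> ((K + L) - Re \<beta> / 2 * \<bar>x\<bar>)\<^sup>2" by simp
      moreover have "Re \<beta> * M = (K + L)\<^sup>2" using assms by (simp add: M_def)
      moreover have "x\<^sup>2 = \<bar>x\<bar>\<^sup>2" by simp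
      ultimately have "Re \<beta> * ((K + L) * \<bar>x\<bar>) \<le> Re \<beta> * (M + Re \<beta> / 4 * x\<^sup>2)"
        unfolding distrib_left[of "Re \<beta>" M] by (simp only:) (simp add: power2_eq_square algebra_simps)
      then show ?thesis using assms by (simp add: mult_le_cancel_left)
    qed
    then have e: "exp ((K + L) * \<bar>x\<bar> - Re \<beta> / 2 * x\<^sup>2) \<le> exp (M - Re \<beta> / 4 * x\<^sup>2)" by simp
    have "norm (gauss \<beta> p x) = norm (poly p (of_real x)) * exp (- Re \<beta> / 2 * x\<^sup>2)"
      by (simp add: gauss_def norm_mult power2_eq_square)
    also have "\<dots> \<le> C * exp (K * \<bar>x\<bar>) * exp (- Re \<beta> / 2 * x\<^sup>2)"
      by (intro mult_right_mono CK) auto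
    finally have "norm (gauss \<beta> p x) * exp (L * \<bar>x\<bar>) \<le> C * exp (K * \<bar>x\<bar>) * exp (- Re \<beta> / 2 * x\<^sup>2) * exp (L * \<bar>x\<bar>)"
      by (intro mult_right_mono) auto
    also have "\<dots> = C * exp ((K + L) * \<bar>x\<bar> - Re \<beta> / 2 * x\<^sup>2)"
    proof -
      have "(K + L) * \<bar>x\<bar> - Re \<beta> / 2 * x\<^sup>2 = K * \<bar>x\<bar> + - Re \<beta> / 2 * x\<^sup>2 + L * \<bar>x\<bar>"
        by (simp add: algebra_simps)
      then show ?thesis by (simp only: exp_add mult.assoc)
    qed
    also have "\<dots> \<le> C * exp (M - Re \<beta> / 4 * x\<^sup>2)" using e CK by (intro mult_left_mono)
    also have "\<dots> = (C * exp M) * exp (- (Re \<beta> / 4) * x\<^sup>2)"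
    proof -
      have "M - Re \<beta> / 4 * x\<^sup>2 = M + - (Re \<beta> / 4) * x\<^sup>2" by simp
      then show ?thesis by (simp only: exp_add mult.assoc)
    qed
    finally show ?thesis .
  qed
  then show ?thesis using CK by (intro exI[of _ "C * exp M"]) auto
qed

section \<open>Integrability and integration by parts for Gaussians\<close>

lemma integrable_exp_minus_square:
  assumes "0 < c" shows "integrable lborel (\<lambda>x::real. exp (- c * x\<^sup>2))"
proof -
  \<comment> \<open>The standard deviation for which the normal density is proportional to exp(-c
    x^2).\<close>
  define s where "s = sqrt (1 / (2 * c))"
  have s: "0 < s" "2 * s\<^sup>2 = 1 / c" using assms by (auto simp: s_def)
  have k: "0 < sqrt (2 * pi * s\<^sup>2)" using s(1) by simp
  have "integrable lborel (\<lambda>x. sqrt (2 * pi * s\<^sup>2) * normal_density 0 s x)"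
    using s(1) by (intro integrable_mult_right integrable_normal_density) simp
  moreover have "sqrt (2 * pi * s\<^sup>2) * normal_density 0 s x = exp (- c * x\<^sup>2)" for x
  proof -
    have "sqrt (2 * pi * s\<^sup>2) * normal_density 0 s x = exp (- (x - 0)\<^sup>2 / (2 * s\<^sup>2))"
      using s(1) unfolding normal_density_def by simp
    also have "\<dots> = exp (- c * x\<^sup>2)" unfolding s(2) by simp
    finally show ?thesis .
  qed
  ultimately show ?thesis by simp
qed

lemma gauss_integrable:
  assumes "0 < Re \<beta>" shows "integrable lborel (gauss \<beta> p)"
proof -
  obtain C where C: "\<And>x. norm (gauss \<beta> p x) * exp (0 * \<bar>x\<bar>) \<le> C * exp (- (Re \<beta> / 4) * x\<^sup>2)"
    using gauss_bound[OF assms, of p 0] by blast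
  have "integrable lborel (\<lambda>x. C * exp (- (Re \<beta> / 4) * x\<^sup>2))"
    using assms by (intro integrable_mult_right integrable_exp_minus_square) auto
  then show ?thesis
  proof (rule Bochner_Integration.integrable_bound)
    show "AE x in lborel. norm (gauss \<beta> p x) \<le> norm (C * exp (- (Re \<beta> / 4) * x\<^sup>2))"
      using order_trans[OF C abs_ge_self] by simp
  qed measurable
qed

lemma gauss_exp_L2:
  assumes "0 < Re \<beta>" shows "(\<lambda>x. norm (gauss \<beta> p x) * exp (L * \<bar>x\<bar>)) \<in> L2 lborel"
proof -
  obtain C where C: "0 \<le> C" "\<And>x. norm (gauss \<beta> p x) * exp (L * \<bar>x\<bar>) \<le> C * exp (- (Re \<beta> / 4) * x\<^sup>2)"
    using gauss_bound[OF assms, of p L] by blast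
  have "integrable lborel (\<lambda>x. C\<^sup>2 * exp (- (Re \<beta> / 2) * x\<^sup>2))"
    using assms by (intro integrable_mult_right integrable_exp_minus_square) auto
  then have "integrable lborel (\<lambda>x. (norm (norm (gauss \<beta> p x) * exp (L * \<bar>x\<bar>)))\<^sup>2)"
  proof (rule Bochner_Integration.integrable_bound)
    show "AE x in lborel. norm ((norm (norm (gauss \<beta> p x) * exp (L * \<bar>x\<bar>)))\<^sup>2) \<le> norm (C\<^sup>2 * exp (- (Re \<beta> / 2) * x\<^sup>2))"
    proof (rule AE_I2)
      fix x
      have "(norm (gauss \<beta> p x) * exp (L * \<bar>x\<bar>))\<^sup>2 \<le> (C * exp (- (Re \<beta> / 4) * x\<^sup>2))\<^sup>2"
        by (intro power_mono C) auto
      also have "\<dots> = C\<^sup>2 * exp (- (Re \<beta> / 2) * x\<^sup>2)"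
        by (simp add: power_mult_distrib flip: exp_double)
      finally show "norm ((norm (norm (gauss \<beta> p x) * exp (L * \<bar>x\<bar>)))\<^sup>2) \<le> norm (C\<^sup>2 * exp (- (Re \<beta> / 2) * x\<^sup>2))"
        by simp
    qed
  qed measurable
  then show ?thesis by (simp add: L2_def)
qed

lemma gauss_L2:
  assumes "0 < Re \<beta>" shows "gauss \<beta> p \<in> L2 lborel"
  by (rule L2_dominated[OF gauss_exp_L2[OF assms, of p 0], where C=1]) auto

text \<open>The fundamental theorem of calculus on the whole line; taking \<open>L = 1\<close> in
  \<open>gauss_bound\<close> gives exponential decay, so the boundary values vanish. All later
  recursions for integrals rest on this.\<close>

lemma gauss_integral_deriv:
  assumes "0 < Re \<beta>" shows "(LINT x|lborel. gauss \<beta> (gauss_deriv \<beta> p) x) = 0"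
proof -
  obtain C where C: "\<And>x. norm (gauss \<beta> p x) * exp (1 * \<bar>x\<bar>) \<le> C * exp (- (Re \<beta> / 4) * x\<^sup>2)" "0 \<le> C"
    using gauss_bound[OF assms, of p 1] by blast
  have bound: "norm (gauss \<beta> p x) \<le> C * exp (- \<bar>x\<bar>)" for x
  proof -
    have "norm (gauss \<beta> p x) * exp (1 * \<bar>x\<bar>) \<le> C * 1"
      using assms by (intro order_trans[OF C(1)] mult_left_mono C(2)) auto
    then show ?thesis by (simp add: exp_minus field_simps)
  qed
  have top: "(gauss \<beta> p \<longlongrightarrow> 0) at_top"
  proof (rule Lim_null_comparison)
    show "\<forall>\<^sub>F x in at_top. norm (gauss \<beta> p x) \<le> C * exp (- x)"
      using eventually_ge_at_top[of 0] by eventually_elim (use bound in \<open>metis abs_of_nonneg abs_of_nonpos minus_minus\<close>)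
    show "((\<lambda>x. C * exp (- x)) \<longlongrightarrow> 0) at_top"
      by (intro tendsto_mult_right_zero filterlim_compose[OF exp_at_bot filterlim_uminus_at_bot_at_top])
  qed
  have bot: "(gauss \<beta> p \<longlongrightarrow> 0) at_bot"
  proof (rule Lim_null_comparison)
    show "\<forall>\<^sub>F x in at_bot. norm (gauss \<beta> p x) \<le> C * exp x"
      using eventually_le_at_bot[of 0] by eventually_elim (use bound in \<open>metis abs_of_nonneg abs_of_nonpos minus_minus\<close>)
    show "((\<lambda>x::real. C * exp x) \<longlongrightarrow> 0) at_bot"
      by (intro tendsto_mult_right_zero exp_at_bot)
  qed
  have "(LBINT x=-\<infinity>..\<infinity>. gauss \<beta> (gauss_deriv \<beta> p) x) = 0 - 0"
    by (rule interval_integral_FTC_integrable[where F="gauss \<beta> p"])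
      (auto simp: gauss_has_vector_derivative gauss_isCont ereal_tendsto_simps top bot
        set_integrable_def gauss_integrable[OF assms])
  then show ?thesis by (simp add: interval_lebesgue_integral_def set_lebesgue_integral_def)
qed

text \<open>Test functions are real, so the identity is first obtained for real parts. The imaginary
  part of \<open>gauss \<beta> p\<close> is the real part for the polynomial -i p, so the same
  family covers both.\<close>

lemma weak_deriv_gauss:
  assumes wd: "has_weak_deriv f g" and f: "f \<in> L2 lborel" and g: "g \<in> L2 lborel" and \<beta>: "0 < Re \<beta>"
  shows "(LINT x|lborel. gauss \<beta> (gauss_deriv \<beta> p) x * f x) = - (LINT x|lborel. gauss \<beta> p x * g x)"
proof -
  have L: "(\<lambda>x. Re (gauss \<beta> p x)) \<in> L2 lborel" for p
    by (rule L2_dominated[OF gauss_L2[OF \<beta>, of p], where C=1]) (auto simp: abs_Re_le_cmod)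
  have d: "deriv (\<lambda>x. Re (gauss \<beta> p x)) = (\<lambda>x. Re (gauss \<beta> (gauss_deriv \<beta> p) x))" for p
    by (intro ext DERIV_imp_deriv Re_gauss_DERIV)
  have re: "(LINT x|lborel. of_real (Re (gauss \<beta> (gauss_deriv \<beta> p) x)) * f x) = - (LINT x|lborel. of_real (Re (gauss \<beta> p x)) * g x)" for p
    using has_weak_deriv_smooth_L2[OF wd f g smooth_Re_gauss L, of p] L[of "gauss_deriv \<beta> p"] unfolding d by blast
  have Li: "(\<lambda>x. complex_of_real (Re (gauss \<beta> p x))) \<in> L2 lborel" for p
    by (rule L2_dominated[OF L[of p], where C=1]) auto
  have dec: "gauss \<beta> p x = of_real (Re (gauss \<beta> p x)) + \<i> * of_real (Re (gauss \<beta> (smult (- \<i>) p) x))" for p x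
    by (simp only: gauss_smult) (simp add: complex_eq_iff)
  have int: "(LINT x|lborel. gauss \<beta> p x * h x) = (LINT x|lborel. of_real (Re (gauss \<beta> p x)) * h x)
      + \<i> * (LINT x|lborel. of_real (Re (gauss \<beta> (smult (- \<i>) p) x)) * h x)" if h: "h \<in> L2 lborel" for p h
  proof -
    have "(LINT x|lborel. gauss \<beta> p x * h x) = (LINT x|lborel. of_real (Re (gauss \<beta> p x)) * h x
      + \<i> * (of_real (Re (gauss \<beta> (smult (- \<i>) p) x)) * h x))"
      by (subst dec) (simp add: algebra_simps)
    also have "\<dots> = (LINT x|lborel. of_real (Re (gauss \<beta> p x)) * h x)
      + \<i> * (LINT x|lborel. of_real (Re (gauss \<beta> (smult (- \<i>) p) x)) * h x)"
      by (simp add: L2_mult_integrable[OF Li h])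
    finally show ?thesis .
  qed
  have "gauss_deriv \<beta> (smult (- \<i>) p) = smult (- \<i>) (gauss_deriv \<beta> p)"
    by (simp add: gauss_deriv_def pderiv_smult pderiv_minus smult_diff_right)
  then show ?thesis unfolding int[OF f] int[OF g] using re[of p] re[of "smult (- \<i>) p"] by simp
qed

text \<open>Exponential moments allow the power series of \<open>iexp (t * x)\<close> to be
  integrated term by term for every t, so vanishing moments force the Fourier transform to vanish.
  The positive and negative parts of r, normalized to probability densities, then have the same
  characteristic function and agree by Levy's uniqueness theorem.\<close>

lemma moment_determinacy:
  fixes r :: "real \<Rightarrow> real"
  assumes [measurable]: "r \<in> borel_measurable borel"
    and exp_int: "\<And>K. integrable lborel (\<lambda>x. exp (K * \<bar>x\<bar>) * \<bar>r x\<bar>)"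
    and moments: "\<And>k. (LINT x|lborel. x ^ k * r x) = 0"
  shows "AE x in lborel. r x = 0"
proof -
  have int: "integrable lborel (\<lambda>x. x ^ k * r x)" for k
  proof (rule Bochner_Integration.integrable_bound[OF integrable_mult_right[where c="fact k", OF exp_int[of 1]]])
    show "AE x in lborel. norm (x ^ k * r x) \<le> norm (fact k * (exp (1 * \<bar>x\<bar>) * \<bar>r x\<bar>))"
    proof (rule AE_I2)
      fix x :: real
      \<comment> \<open>A single term of the exponential series bounds the power.\<close>
      have "\<bar>x\<bar> ^ k / fact k \<le> exp \<bar>x\<bar>"
        using sum_le_suminf[OF summable_exp[of "\<bar>x\<bar>"], of "{k}"]
        by (simp add: exp_def scaleR_conv_of_real divide_inverse mult.commute)
      then have "\<bar>x\<bar> ^ k * \<bar>r x\<bar> \<le> (fact k * exp \<bar>x\<bar>) * \<bar>r x\<bar>"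
        by (intro mult_right_mono) (auto simp: field_simps)
      then show "norm (x ^ k * r x) \<le> norm (fact k * (exp (1 * \<bar>x\<bar>) * \<bar>r x\<bar>))"
        by (simp add: abs_mult power_abs)
    qed
  qed measurable
  have int0: "integrable lborel r" using int[of 0] by simp
  have fourier: "(LINT x|lborel. iexp (t * x) * r x) = 0" for t
  proof -
    define s where "s N x = (\<Sum>k<N. (\<i> * of_real (t * x)) ^ k /\<^sub>R fact k) * complex_of_real (r x)" for N x
    have s: "s N x = (\<Sum>k<N. ((\<i> * of_real t) ^ k / of_nat (fact k)) * complex_of_real (x ^ k * r x))" for N x
      unfolding s_def sum_distrib_right
      by (intro sum.cong refl) (simp add: power_mult_distrib scaleR_conv_of_real field_simps)
    have [measurable]: "s N \<in> borel_measurable borel" for N unfolding s_def by measurable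
    have intc: "integrable lborel (\<lambda>x. ((\<i> * of_real t) ^ k / of_nat (fact k)) * complex_of_real (x ^ k * r x))" for k
      by (intro integrable_mult_right integrable_of_real int)
    have "integral\<^sup>L lborel (s N) = 0" for N
    proof -
      have "integral\<^sup>L lborel (s N) = (\<Sum>k<N. LINT x|lborel. ((\<i> * of_real t) ^ k / of_nat (fact k)) * complex_of_real (x ^ k * r x))"
        unfolding s[abs_def] by (rule Bochner_Integration.integral_sum[OF intc])
      also have "\<dots> = 0"
        by (intro sum.neutral ballI) (simp only: integral_mult_right_zero integral_complex_of_real moments of_real_0 mult_zero_right)
      finally show ?thesis .
    qed
    moreover have "(\<lambda>N. integral\<^sup>L lborel (s N)) \<longlonglongrightarrow> (LINT x|lborel. iexp (t * x) * r x)"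
    proof (rule integral_dominated_convergence[where w="\<lambda>x. exp (\<bar>t\<bar> * \<bar>x\<bar>) * \<bar>r x\<bar>"])
      show "AE x in lborel. (\<lambda>N. s N x) \<longlonglongrightarrow> iexp (t * x) * r x"
      proof (rule AE_I2)
        fix x
        have "(\<lambda>k. (\<i> * of_real (t * x)) ^ k /\<^sub>R fact k) sums iexp (t * x)" by (rule exp_converges)
        then show "(\<lambda>N. s N x) \<longlonglongrightarrow> iexp (t * x) * r x"
          unfolding s_def sums_def by (intro tendsto_intros)
      qed
      show "AE x in lborel. norm (s N x) \<le> exp (\<bar>t\<bar> * \<bar>x\<bar>) * \<bar>r x\<bar>" for N
      proof (rule AE_I2)
        fix x
        have "norm (\<Sum>k<N. (\<i> * of_real (t * x)) ^ k /\<^sub>R fact k :: complex) \<le> (\<Sum>k<N. \<bar>t * x\<bar> ^ k /\<^sub>R fact k)"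
          by (rule order_trans[OF norm_sum]) (simp add: norm_mult norm_power abs_mult)
        also have "\<dots> \<le> exp \<bar>t * x\<bar>"
          unfolding exp_def by (rule sum_le_suminf[OF summable_exp_generic]) auto
        finally show "norm (s N x) \<le> exp (\<bar>t\<bar> * \<bar>x\<bar>) * \<bar>r x\<bar>"
          unfolding s_def norm_mult abs_mult by (simp add: mult_right_mono)
      qed
    qed (use exp_int in auto)
    ultimately show ?thesis by (simp add: LIMSEQ_const_iff)
  qed
  define p where "p x = max 0 (r x)" for x
  define n where "n x = max 0 (- r x)" for x
  have [measurable]: "p \<in> borel_measurable borel" "n \<in> borel_measurable borel"
    unfolding p_def n_def by measurable
  have pn: "r x = p x - n x" "0 \<le> p x" "0 \<le> n x" for x by (auto simp: p_def n_def)
  have ip: "integrable lborel p" and inn: "integrable lborel n"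
    by (rule Bochner_Integration.integrable_bound[OF int0]; simp add: p_def n_def)+
  \<comment> \<open>The common mass of both parts, by the vanishing zeroth moment. If it is 0, no
    normalization is possible, but then both parts vanish outright.\<close>
  define M where "M = integral\<^sup>L lborel p"
  have "integral\<^sup>L lborel p - integral\<^sup>L lborel n = integral\<^sup>L lborel r"
    unfolding pn(1) by (rule Bochner_Integration.integral_diff[OF ip inn, symmetric])
  also have "\<dots> = 0" using moments[of 0] by simp
  finally have Mn: "M = integral\<^sup>L lborel n" by (simp add: M_def)
  show ?thesis
  proof (cases "M = 0")
    case True
    have "AE x in lborel. p x = 0"
      using integral_nonneg_eq_0_iff_AE[OF ip] True pn unfolding M_def by auto
    moreover have "AE x in lborel. n x = 0"
      using integral_nonneg_eq_0_iff_AE[OF inn] True pn unfolding Mn by auto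
    ultimately show ?thesis by eventually_elim (simp add: pn)
  next
    case False
    moreover have "0 \<le> M" unfolding M_def by (rule integral_nonneg_AE) (simp add: pn)
    ultimately have M: "0 < M" by simp
    have dist: "real_distribution (density lborel (\<lambda>x. ennreal (f x / M)))"
      if [measurable]: "f \<in> borel_measurable borel" and f: "integrable lborel f" "\<And>x. 0 \<le> f x" "M = integral\<^sup>L lborel f" for f
    proof -
      have "emeasure (density lborel (\<lambda>x. ennreal (f x / M))) UNIV = (\<integral>\<^sup>+ x. ennreal (f x / M) \<partial>lborel)"
        by (subst emeasure_density) auto
      also have "\<dots> = ennreal (LINT x|lborel. f x / M)"
        using f M by (intro nn_integral_eq_integral) auto
      also have "\<dots> = 1" using f(3) M by simp
      finally show ?thesis by (auto simp: real_distribution_def real_distribution_axioms_def intro!: prob_spaceI)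
    qed
    have char: "char (density lborel (\<lambda>x. ennreal (f x / M))) t = (LINT x|lborel. iexp (t * x) * f x) / M"
      if [measurable]: "f \<in> borel_measurable borel" and "\<And>x. 0 \<le> f x" for f t
    proof -
      have "char (density lborel (\<lambda>x. ennreal (f x / M))) t = (LINT x|lborel. (f x / M) *\<^sub>R iexp (t * x))"
        unfolding char_def using that M by (subst integral_density) auto
      also have "\<dots> = (LINT x|lborel. (iexp (t * x) * f x) / M)"
        by (intro Bochner_Integration.integral_cong) (auto simp: scaleR_conv_of_real)
      finally show ?thesis by simp
    qed
    have iexp_int: "integrable lborel (\<lambda>x. iexp (t * x) * complex_of_real (f x))"
      if [measurable]: "f \<in> borel_measurable borel" and f: "integrable lborel f" for f t
      by (rule Bochner_Integration.integrable_bound[OF f]) (auto simp: norm_mult)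
    have "char (density lborel (\<lambda>x. ennreal (p x / M))) = char (density lborel (\<lambda>x. ennreal (n x / M)))"
    proof
      fix t
      have "0 = (LINT x|lborel. iexp (t * x) * p x - iexp (t * x) * n x)"
        using fourier[of t] by (simp add: pn(1) algebra_simps)
      also have "\<dots> = (LINT x|lborel. iexp (t * x) * p x) - (LINT x|lborel. iexp (t * x) * n x)"
        by (intro Bochner_Integration.integral_diff iexp_int ip inn) auto
      finally show "char (density lborel (\<lambda>x. ennreal (p x / M))) t = char (density lborel (\<lambda>x. ennreal (n x / M))) t"
        by (simp add: char pn)
    qed
    then have "density lborel (\<lambda>x. ennreal (p x / M)) = density lborel (\<lambda>x. ennreal (n x / M))"
      by (intro Levy_uniqueness dist ip inn pn Mn M_def) auto
    then have "AE x in lborel. ennreal (p x / M) = ennreal (n x / M)"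
      by (intro sigma_finite_measure.density_unique[OF lborel.sigma_finite_measure_axioms]) auto
    then show ?thesis
      by eventually_elim (use M pn in \<open>simp add: ennreal_inj\<close>)
  qed
qed

text \<open>The product of h with the Gaussian has all exponential moments by Cauchy-Schwarz,
  although h is merely square integrable. Moment determinacy applies to its real and imaginary
  parts, and the Gaussian has no zeros.\<close>

lemma gauss_moments_complete:
  assumes \<beta>: "0 < Re \<beta>" and h: "h \<in> L2 lborel"
    and moments: "\<And>k. (LINT x|lborel. gauss \<beta> (monom 1 k) x * h x) = 0"
  shows "AE x in lborel. h x = 0"
proof -
  define q where "q x = gauss \<beta> 1 x * h x" for x
  have [measurable]: "h \<in> borel_measurable borel" using L2_measurable[OF h] by simp
  have [measurable]: "q \<in> borel_measurable borel" unfolding q_def by measurable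
  have qint: "integrable lborel (\<lambda>x. exp (K * \<bar>x\<bar>) * norm (q x))" for K
    using L2_norm_mult_integrable[OF gauss_exp_L2[OF \<beta>, of 1 K] h] by (simp add: q_def norm_mult mult_ac)
  have mint: "integrable lborel (\<lambda>x. of_real (x ^ k) * q x)" for k
    using L2_mult_integrable[OF gauss_L2[OF \<beta>, of "monom 1 k"] h]
    by (simp add: q_def gauss_def poly_monom mult_ac)
  have m: "(LINT x|lborel. of_real (x ^ k) * q x) = 0" for k
    using moments[of k] by (simp add: q_def gauss_def poly_monom mult_ac)
  have "AE x in lborel. Re (q x) = 0"
  proof (rule moment_determinacy)
    fix k
    have "(LINT x|lborel. x ^ k * Re (q x)) = (LINT x|lborel. Re (of_real (x ^ k) * q x))"
      by (intro Bochner_Integration.integral_cong) (auto simp del: of_real_power)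
    then show "(LINT x|lborel. x ^ k * Re (q x)) = 0" using integral_Re[OF mint] m by simp
  next
    fix K show "integrable lborel (\<lambda>x. exp (K * \<bar>x\<bar>) * \<bar>Re (q x)\<bar>)"
      by (rule Bochner_Integration.integrable_bound[OF qint[of K]]) (auto simp: abs_Re_le_cmod)
  qed measurable
  moreover have "AE x in lborel. Im (q x) = 0"
  proof (rule moment_determinacy)
    fix k
    have "(LINT x|lborel. x ^ k * Im (q x)) = (LINT x|lborel. Im (of_real (x ^ k) * q x))"
      by (intro Bochner_Integration.integral_cong) (auto simp del: of_real_power)
    then show "(LINT x|lborel. x ^ k * Im (q x)) = 0" using integral_Im[OF mint] m by simp
  next
    fix K show "integrable lborel (\<lambda>x. exp (K * \<bar>x\<bar>) * \<bar>Im (q x)\<bar>)"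
      by (rule Bochner_Integration.integrable_bound[OF qint[of K]]) (auto simp: abs_Im_le_cmod)
  qed measurable
  ultimately have "AE x in lborel. q x = 0" by eventually_elim (simp add: complex_eq_iff)
  then show ?thesis by eventually_elim (simp add: q_def gauss_def)
qed

section \<open>Rotated Hermite functions\<close>

text \<open>The physicists' Hermite polynomials at y = \<omega> x: this is H_(n+1) = 2 y H_n - H_n',
  where the chain rule accounts for the factor 1/\<omega>.\<close>

fun herm :: "complex \<Rightarrow> nat \<Rightarrow> complex poly" where
  "herm \<omega> 0 = 1"
| "herm \<omega> (Suc n) = [:0, 2 * \<omega>:] * herm \<omega> n - smult (1 / \<omega>) (pderiv (herm \<omega> n))"

text \<open>The classical relation H_n' = 2 n H_(n-1). Differentiating the recursion and inserting
  the induction hypothesis reproduces the recursion one level lower.\<close>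

lemma pderiv_herm_Suc: "pderiv (herm \<omega> (Suc n)) = smult (2 * of_nat (Suc n) * \<omega>) (herm \<omega> n)"
proof (induction n)
  case 0
  show ?case by (simp add: pderiv_pCons pderiv_1)
next
  case (Suc n)
  define c where "c = 2 * of_nat (Suc n) * \<omega>"
  have IH: "pderiv (herm \<omega> (Suc n)) = smult c (herm \<omega> n)" using Suc by (simp only: c_def)
  have "pderiv (herm \<omega> (Suc (Suc n))) = smult (2 * \<omega>) (herm \<omega> (Suc n)) + [:0, 2 * \<omega>:] * smult c (herm \<omega> n)
      - smult (1 / \<omega>) (pderiv (smult c (herm \<omega> n)))"
    unfolding herm.simps(2)[of \<omega> "Suc n"] IH pderiv_diff pderiv_mult pderiv_smult
    by (simp add: pderiv_pCons)
  also have "\<dots> = smult (2 * \<omega>) (herm \<omega> (Suc n)) + smult c (herm \<omega> (Suc n))"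
    by (simp add: pderiv_smult smult_diff_right mult.commute)
  also have "\<dots> = smult (2 * of_nat (Suc (Suc n)) * \<omega>) (herm \<omega> (Suc n))"
    unfolding c_def smult_add_left[symmetric] by (simp add: algebra_simps)
  finally show ?case .
qed

lemma gauss_zero [simp]: "gauss \<beta> 0 = (\<lambda>x. 0)"
  by (simp add: gauss_def fun_eq_iff)

lemma gauss_integral_pderiv:
  assumes "0 < Re \<beta>"
  shows "(LINT x|lborel. gauss \<beta> (pderiv p) x) = (LINT x|lborel. gauss \<beta> ([:0, \<beta>:] * p) x)"
proof -
  have "(LINT x|lborel. gauss \<beta> (pderiv p) x) - (LINT x|lborel. gauss \<beta> ([:0, \<beta>:] * p) x)
      = (LINT x|lborel. gauss \<beta> (gauss_deriv \<beta> p) x)"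
    unfolding gauss_deriv_def gauss_diff
    by (rule Bochner_Integration.integral_diff[symmetric]) (rule gauss_integrable[OF assms])+
  then show ?thesis using gauss_integral_deriv[OF assms] by simp
qed

locale rotated_hermite =
  fixes \<omega> :: complex
  assumes Re_pos: "0 < Re (\<omega>\<^sup>2)"
begin

lemma nonzero: "\<omega> \<noteq> 0"
  using Re_pos by auto

definition psi :: "nat \<Rightarrow> real \<Rightarrow> complex" where
  "psi n = gauss (\<omega>\<^sup>2) (herm \<omega> n)"

lemma psi_L2: "psi n \<in> L2 lborel"
  unfolding psi_def by (rule gauss_L2[OF Re_pos])

text \<open>Reduces to moments. The recursion writes x times \<open>herm \<omega> n\<close> through
  \<open>herm \<omega> (Suc n)\<close> and the derivative of \<open>herm \<omega> n\<close>, a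
  multiple of a lower one. Hence orthogonality passes from the power k to \<open>Suc k\<close>
  provided it is claimed for all n at once; \<open>n = 0\<close> gives the monomials.\<close>

lemma psi_complete:
  assumes h: "h \<in> L2 lborel" and orth: "\<And>n. (LINT x|lborel. psi n x * h x) = 0"
  shows "AE x in lborel. h x = 0"
proof (rule gauss_moments_complete[OF Re_pos h])
  have int: "integrable lborel (\<lambda>x. gauss (\<omega>\<^sup>2) p x * h x)" for p
    by (rule L2_mult_integrable[OF gauss_L2[OF Re_pos] h])
  have lower: "(LINT x|lborel. gauss (\<omega>\<^sup>2) (monom 1 k * pderiv (herm \<omega> n)) x * h x) = 0"
    if "\<And>n. (LINT x|lborel. gauss (\<omega>\<^sup>2) (monom 1 k * herm \<omega> n) x * h x) = 0" for k n
  proof (cases n)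
    case (Suc m)
    show ?thesis
      unfolding Suc pderiv_herm_Suc mult_smult_right gauss_smult mult.assoc integral_mult_right_zero that
      by simp
  qed (simp add: pderiv_1)
  have "(LINT x|lborel. gauss (\<omega>\<^sup>2) (monom 1 k * herm \<omega> n) x * h x) = 0" for k n
  proof (induction k arbitrary: n)
    case 0
    show ?case using orth[of n] by (simp add: psi_def)
  next
    case (Suc k)
    have "smult (2 * \<omega>) (monom 1 (Suc k) * herm \<omega> n)
        = monom 1 k * herm \<omega> (Suc n) + smult (1 / \<omega>) (monom 1 k * pderiv (herm \<omega> n))"
      by (simp add: monom_Suc algebra_simps)
    then have g: "2 * \<omega> * gauss (\<omega>\<^sup>2) (monom 1 (Suc k) * herm \<omega> n) x
        = gauss (\<omega>\<^sup>2) (monom 1 k * herm \<omega> (Suc n)) x + (1 / \<omega>) * gauss (\<omega>\<^sup>2) (monom 1 k * pderiv (herm \<omega> n)) x" for x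
      by (metis gauss_add gauss_smult)
    have "2 * \<omega> * (gauss (\<omega>\<^sup>2) (monom 1 (Suc k) * herm \<omega> n) x * h x)
        = gauss (\<omega>\<^sup>2) (monom 1 k * herm \<omega> (Suc n)) x * h x
          + (1 / \<omega>) * (gauss (\<omega>\<^sup>2) (monom 1 k * pderiv (herm \<omega> n)) x * h x)" for x
      by (simp only: mult.assoc[symmetric] g distrib_right)
    then have "2 * \<omega> * (LINT x|lborel. gauss (\<omega>\<^sup>2) (monom 1 (Suc k) * herm \<omega> n) x * h x)
        = (LINT x|lborel. gauss (\<omega>\<^sup>2) (monom 1 k * herm \<omega> (Suc n)) x * h x
          + (1 / \<omega>) * (gauss (\<omega>\<^sup>2) (monom 1 k * pderiv (herm \<omega> n)) x * h x))"
      by (simp only: integral_mult_right_zero[symmetric])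
    also have "\<dots> = (LINT x|lborel. gauss (\<omega>\<^sup>2) (monom 1 k * herm \<omega> (Suc n)) x * h x)
          + (1 / \<omega>) * (LINT x|lborel. gauss (\<omega>\<^sup>2) (monom 1 k * pderiv (herm \<omega> n)) x * h x)"
      unfolding integral_mult_right_zero[symmetric]
      by (intro Bochner_Integration.integral_add integrable_mult_right int)
    also have "\<dots> = 0" by (simp only: Suc lower[OF Suc]) simp
    finally show ?case using nonzero by simp
  qed
  from this[of _ 0] show "(LINT x|lborel. gauss (\<omega>\<^sup>2) (monom 1 k) x * h x) = 0" for k
    by simp
qed

section \<open>Bilinear orthogonality and Gaussian overlaps\<close>

definition kappa :: complex where
  "kappa = (LINT x|lborel. psi 0 x * psi 0 x)"

text \<open>The product of the two Gaussians has parameter 2 \<omega>^2, so the factor 2 \<omega> x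
  in the recursion is 1/\<omega> times what integration by parts turns into a derivative. That
  derivative falls on both polynomials; the part on \<open>herm \<omega> j\<close> cancels the
  subtracted term of the recursion.\<close>

lemma psi_pairing_Suc:
  "(LINT x|lborel. psi (Suc j) x * psi k x) = (1 / \<omega>) * (LINT x|lborel. gauss (\<omega>\<^sup>2 + \<omega>\<^sup>2) (herm \<omega> j * pderiv (herm \<omega> k)) x)"
proof -
  define \<beta> where "\<beta> = \<omega>\<^sup>2 + \<omega>\<^sup>2"
  have \<beta>: "0 < Re \<beta>" using Re_pos by (simp add: \<beta>_def)
  define q where "q = herm \<omega> j * herm \<omega> k"
  have e: "herm \<omega> (Suc j) * herm \<omega> k = smult (1 / \<omega>) ([:0, \<beta>:] * q) - smult (1 / \<omega>) (pderiv q)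
      + smult (1 / \<omega>) (herm \<omega> j * pderiv (herm \<omega> k))"
  proof -
    have "smult (1 / \<omega>) [:0, \<beta>:] = [:0, 2 * \<omega>:]"
      using nonzero by (simp add: \<beta>_def power2_eq_square)
    then have "smult (1 / \<omega>) ([:0, \<beta>:] * q) = [:0, 2 * \<omega>:] * q"
      by (metis mult_smult_left)
    then show ?thesis by (simp add: q_def pderiv_mult algebra_simps smult_add_right)
  qed
  have "(LINT x|lborel. psi (Suc j) x * psi k x) = (LINT x|lborel. gauss \<beta> (herm \<omega> (Suc j) * herm \<omega> k) x)"
    by (simp only: psi_def gauss_mult \<beta>_def)
  also have "\<dots> = (1 / \<omega>) * (LINT x|lborel. gauss \<beta> ([:0, \<beta>:] * q) x) - (1 / \<omega>) * (LINT x|lborel. gauss \<beta> (pderiv q) x)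
      + (1 / \<omega>) * (LINT x|lborel. gauss \<beta> (herm \<omega> j * pderiv (herm \<omega> k)) x)"
    unfolding e gauss_add gauss_diff gauss_smult integral_mult_right_zero[symmetric]
    by (subst Bochner_Integration.integral_add Bochner_Integration.integral_diff;
        (intro Bochner_Integration.integrable_diff integrable_mult_right gauss_integrable \<beta>)?)+ simp
  finally show ?thesis unfolding gauss_integral_pderiv[OF \<beta>] by (simp add: \<beta>_def)
qed

text \<open>Each step lowers both indices by one, until an index 0 is reached; there a nonzero
  partner gives 0, because the derivative of a constant vanishes.\<close>

lemma psi_biorthogonal:
  "(LINT x|lborel. psi j x * psi k x) = (if j = k then 2 ^ j * fact j * kappa else 0)"
proof (induction j arbitrary: k)
  case 0
  show ?case
  proof (cases k)
    case (Suc k')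
    have "(LINT x|lborel. psi 0 x * psi k x) = (LINT x|lborel. psi (Suc k') x * psi 0 x)"
      by (simp only: Suc mult.commute)
    also have "\<dots> = 0" unfolding psi_pairing_Suc by (simp add: pderiv_1)
    finally show ?thesis by (simp add: Suc)
  qed (simp add: kappa_def)
next
  case (Suc j)
  show ?case
  proof (cases k)
    case 0
    then show ?thesis unfolding psi_pairing_Suc by (simp add: pderiv_1)
  next
    case k: (Suc k')
    have "(LINT x|lborel. psi (Suc j) x * psi k x)
        = (1 / \<omega>) * (LINT x|lborel. gauss (\<omega>\<^sup>2 + \<omega>\<^sup>2) (herm \<omega> j * pderiv (herm \<omega> (Suc k'))) x)"
      by (simp only: psi_pairing_Suc k)
    also have "\<dots> = (1 / \<omega>) * (LINT x|lborel. (2 * of_nat (Suc k') * \<omega>) * (psi j x * psi k' x))"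
      unfolding pderiv_herm_Suc mult_smult_right gauss_smult psi_def gauss_mult ..
    also have "\<dots> = 2 * of_nat (Suc k') * (LINT x|lborel. psi j x * psi k' x)"
      using nonzero by simp
    finally show ?thesis unfolding Suc by (simp add: k)
  qed
qed

text \<open>Otherwise \<open>psi 0\<close> would be orthogonal to every \<open>psi n\<close>, itself
  included, and completeness would force it to vanish. This replaces an evaluation of the complex
  Gaussian integral.\<close>

lemma kappa_nonzero: "kappa \<noteq> 0"
proof
  assume "kappa = 0"
  then have "AE x in lborel. psi 0 x = 0"
    by (intro psi_complete psi_L2) (simp add: psi_biorthogonal)
  then have "AE x in (lborel :: real measure). False" by (simp add: psi_def gauss_def)
  then show False by (simp add: eventually_False ae_filter_eq_bot_iff)
qed

text \<open>Integration by parts as for the self-pairing, but the product Gaussian now has parameter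
  b = \<omega>^2 + \<beta>. The two derivative terms no longer cancel and leave 2 \<omega> / b - 1 /
  \<omega>.\<close>

lemma psi_gauss_overlap_rec:
  assumes \<beta>: "0 < Re \<beta>"
  shows "(LINT x|lborel. psi (Suc n) x * gauss \<beta> 1 x)
    = (\<omega>\<^sup>2 - \<beta>) / (\<omega> * (\<omega>\<^sup>2 + \<beta>)) * (LINT x|lborel. gauss (\<omega>\<^sup>2 + \<beta>) (pderiv (herm \<omega> n)) x)"
proof -
  define b where "b = \<omega>\<^sup>2 + \<beta>"
  have b: "0 < Re b" using Re_pos \<beta> by (simp add: b_def)
  then have b0: "b \<noteq> 0" by auto
  have e: "herm \<omega> (Suc n) = smult (2 * \<omega> / b) ([:0, b:] * herm \<omega> n) - smult (1 / \<omega>) (pderiv (herm \<omega> n))"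
  proof -
    have "smult (2 * \<omega> / b) [:0, b:] = [:0, 2 * \<omega>:]" using b0 by simp
    then have "smult (2 * \<omega> / b) ([:0, b:] * herm \<omega> n) = [:0, 2 * \<omega>:] * herm \<omega> n"
      by (metis mult_smult_left)
    then show ?thesis by simp
  qed
  have "(LINT x|lborel. psi (Suc n) x * gauss \<beta> 1 x) = (LINT x|lborel. gauss b (herm \<omega> (Suc n)) x)"
    by (simp only: psi_def gauss_mult b_def mult_1_right)
  also have "\<dots> = (2 * \<omega> / b) * (LINT x|lborel. gauss b ([:0, b:] * herm \<omega> n) x) - (1 / \<omega>) * (LINT x|lborel. gauss b (pderiv (herm \<omega> n)) x)"
    unfolding e gauss_diff gauss_smult integral_mult_right_zero[symmetric]
    by (intro Bochner_Integration.integral_diff integrable_mult_right gauss_integrable b)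
  also have "\<dots> = (2 * \<omega> / b - 1 / \<omega>) * (LINT x|lborel. gauss b (pderiv (herm \<omega> n)) x)"
    unfolding gauss_integral_pderiv[OF b, symmetric] by (simp add: algebra_simps)
  also have "2 * \<omega> / b - 1 / \<omega> = (\<omega>\<^sup>2 - \<beta>) / (\<omega> * b)"
    using b0 nonzero by (simp add: field_simps power2_eq_square) (simp add: b_def power2_eq_square algebra_simps)
  finally show ?thesis by (simp add: b_def)
qed

text \<open>Two recursion steps multiply the overlap by 2 (n + 1) r. After squaring and dividing by
  2^n n!, consecutive even terms have ratio |r|^2 (n + 1) / (n + 2), which is eventually above a
  constant larger than 1.\<close>

lemma psi_gauss_overlap_unbounded:
  assumes \<beta>: "0 < Re \<beta>" and \<rho>: "1 < norm ((\<omega>\<^sup>2 - \<beta>) / (\<omega>\<^sup>2 + \<beta>))"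
  shows "\<exists>n. B * (2 ^ n * fact n) < (norm (LINT x|lborel. psi n x * gauss \<beta> 1 x))\<^sup>2"
proof -
  define \<gamma> where "\<gamma> n = (LINT x|lborel. psi n x * gauss \<beta> 1 x)" for n
  define r where "r = (\<omega>\<^sup>2 - \<beta>) / (\<omega>\<^sup>2 + \<beta>)"
  have \<gamma>1: "\<gamma> (Suc 0) = 0"
    unfolding \<gamma>_def psi_gauss_overlap_rec[OF \<beta>] by (simp add: pderiv_1)
  have \<gamma>rec: "\<gamma> (Suc (Suc n)) = 2 * of_nat (Suc n) * r * \<gamma> n" for n
  proof -
    have "\<gamma> (Suc (Suc n)) = (\<omega>\<^sup>2 - \<beta>) / (\<omega> * (\<omega>\<^sup>2 + \<beta>)) * ((2 * of_nat (Suc n) * \<omega>) * (LINT x|lborel. gauss (\<omega>\<^sup>2 + \<beta>) (herm \<omega> n) x))"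
      unfolding \<gamma>_def psi_gauss_overlap_rec[OF \<beta>] pderiv_herm_Suc gauss_smult integral_mult_right_zero ..
    also have "(LINT x|lborel. gauss (\<omega>\<^sup>2 + \<beta>) (herm \<omega> n) x) = \<gamma> n"
      by (simp only: \<gamma>_def psi_def gauss_mult mult_1_right)
    finally show ?thesis using nonzero by (simp add: r_def)
  qed
  \<comment> \<open>The recursion would propagate a zero to all overlaps, against
    completeness.\<close>
  have \<gamma>0: "\<gamma> 0 \<noteq> 0"
  proof
    assume "\<gamma> 0 = 0"
    then have "\<gamma> n = 0 \<and> \<gamma> (Suc n) = 0" for n by (induction n) (auto simp: \<gamma>1 \<gamma>rec)
    then have "AE x in lborel. gauss \<beta> 1 x = 0"
      by (intro psi_complete gauss_L2[OF \<beta>]) (simp add: \<gamma>_def)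
    then have "AE x in (lborel :: real measure). False" by (simp add: gauss_def)
    then show False by (simp add: eventually_False ae_filter_eq_bot_iff)
  qed
  \<comment> \<open>Only even indices are sampled: the odd overlaps vanish, by
    \<open>\<gamma>1\<close> and the two-step recursion.\<close>
  define s where "s k = (norm (\<gamma> (2 * k)))\<^sup>2 / (2 ^ (2 * k) * fact (2 * k))" for k
  define R where "R = (norm r)\<^sup>2"
  have R: "1 < R" using \<rho> by (simp add: R_def r_def one_less_power)
  have srec: "s (Suc k) = R * (1 - 1 / (2 * real k + 2)) * s k" for k
  proof -
    define F where "F = (2 ^ (2 * k) * fact (2 * k) :: real)"
    have F: "F > 0" by (simp add: F_def)
    have "\<gamma> (2 * Suc k) = 2 * of_nat (Suc (2 * k)) * r * \<gamma> (2 * k)" using \<gamma>rec[of "2 * k"] by simp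
    then have n: "(norm (\<gamma> (2 * Suc k)))\<^sup>2 = (2 * (2 * real k + 1))\<^sup>2 * R * (norm (\<gamma> (2 * k)))\<^sup>2"
      by (simp only: norm_mult norm_of_nat power_mult_distrib R_def) simp
    have d: "2 ^ (2 * Suc k) * fact (2 * Suc k) = 4 * (2 * real k + 2) * (2 * real k + 1) * F"
      by (simp add: F_def algebra_simps)
    have "s (Suc k) = ((2 * (2 * real k + 1))\<^sup>2 * R * (norm (\<gamma> (2 * k)))\<^sup>2) / (4 * (2 * real k + 2) * (2 * real k + 1) * F)"
      unfolding s_def n d ..
    also have "\<dots> = R * (1 - 1 / (2 * real k + 2)) * ((norm (\<gamma> (2 * k)))\<^sup>2 / F)"
      using F by (simp add: divide_simps) (simp add: power2_eq_square algebra_simps)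
    finally show ?thesis by (simp add: s_def F_def)
  qed
  have spos: "0 < s k" for k
  proof (induction k)
    case (Suc k)
    have "0 < 1 - 1 / (2 * real k + 2)" by simp
    then show ?case using Suc R unfolding srec by (intro mult_pos_pos) auto
  qed (use \<gamma>0 in \<open>simp add: s_def\<close>)
  define q where "q = (R + 1) / 2"
  have q: "1 < q" using R by (simp add: q_def)
  \<comment> \<open>The ratio reaches q, the midpoint of 1 and R, exactly when k + 1 is at least R /
    (R - 1).\<close>
  obtain k0 :: nat where k0: "R / (R - 1) < real k0" using reals_Archimedean2 by blast
  have ratio: "q * s k \<le> s (Suc k)" if "k0 \<le> k" for k
  proof -
    have "R / (R - 1) \<le> real k + 1" using k0 that by linarith
    then have "R \<le> (R - 1) * (real k + 1)" using R by (simp add: field_simps)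
    then have "q \<le> R * (1 - 1 / (2 * real k + 2))"
      unfolding q_def by (simp add: field_simps)
    then show ?thesis unfolding srec using spos[of k] by (intro mult_right_mono) auto
  qed
  have grow: "q ^ j * s k0 \<le> s (k0 + j)" for j
  proof (induction j)
    case (Suc j)
    have "q ^ Suc j * s k0 \<le> q * s (k0 + j)" using Suc q by (simp add: mult.assoc)
    then show ?case using ratio[of "k0 + j"] by simp
  qed simp
  obtain j where "B / s k0 < q ^ j" using real_arch_pow[OF q] by blast
  then have "B < s (k0 + j)" using grow[of j] spos[of k0] by (simp add: field_simps)
  then show ?thesis
    unfolding s_def \<gamma>_def by (intro exI[of _ "2 * (k0 + j)"]) (simp add: field_simps)
qed

end

section \<open>Eigenfunctions\<close>

lemma vector_4:
  "(vector [x, y, z, w] :: ('a::zero)^4) $ 1 = x"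
  "(vector [x, y, z, w] :: ('a::zero)^4) $ 2 = y"
  "(vector [x, y, z, w] :: ('a::zero)^4) $ 3 = z"
  "(vector [x, y, z, w] :: ('a::zero)^4) $ 4 = w"
  unfolding vector_def by simp_all

text \<open>The derivative and x couple component 1 with 4 and 2 with 3, through one of two ladder
  operators; the mass, sitting in off-diagonal blocks, couples 1 with 3 and 2 with 4. Its signs are
  what makes the cross terms cancel when the equation is iterated.\<close>

lemma H_op_components:
  defines "w \<equiv> \<lambda>u i. weak_deriv (\<lambda>y. u y $ i)"
  shows "H_op m \<theta> u x $ 1 = \<i> * (exp (\<i> * of_real \<theta> / 2) * of_real x * u x $ 4 - exp (- \<i> * of_real \<theta> / 2) * w u 4 x) + of_real m * u x $ 3"
    and "H_op m \<theta> u x $ 2 = - \<i> * (exp (\<i> * of_real \<theta> / 2) * of_real x * u x $ 3 + exp (- \<i> * of_real \<theta> / 2) * w u 3 x) - of_real m * u x $ 4"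
    and "H_op m \<theta> u x $ 3 = \<i> * (exp (\<i> * of_real \<theta> / 2) * of_real x * u x $ 2 - exp (- \<i> * of_real \<theta> / 2) * w u 2 x) + of_real m * u x $ 1"
    and "H_op m \<theta> u x $ 4 = - \<i> * (exp (\<i> * of_real \<theta> / 2) * of_real x * u x $ 1 + exp (- \<i> * of_real \<theta> / 2) * w u 1 x) - of_real m * u x $ 2"
  unfolding H_op_def w_def alpha1_def alpha2_def alpha3_def block_matrix_def sigma1_def sigma2_def sigma3_def
    matrix_vector_mult_def
  by (simp_all add: sum_4 vector_4 algebra_simps)

lemma dom_H_weak_deriv:
  assumes "u \<in> dom_H"
  shows "(\<lambda>x. u x $ i) \<in> L2 lborel" "weak_deriv (\<lambda>x. u x $ i) \<in> L2 lborel"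
    "has_weak_deriv (\<lambda>x. u x $ i) (weak_deriv (\<lambda>x. u x $ i))"
proof -
  have h: "(\<lambda>x. u x $ i) \<in> H1" using assms by (auto simp: dom_H_def dom_component_def)
  then show "(\<lambda>x. u x $ i) \<in> L2 lborel" by (simp add: H1_def)
  have "\<exists>g. g \<in> L2 lborel \<and> has_weak_deriv (\<lambda>x. u x $ i) g" using h by (auto simp: H1_def)
  from someI_ex[OF this]
  show "weak_deriv (\<lambda>x. u x $ i) \<in> L2 lborel" "has_weak_deriv (\<lambda>x. u x $ i) (weak_deriv (\<lambda>x. u x $ i))"
    unfolding weak_deriv_def by blast+
qed

context rotated_hermite
begin

text \<open>Integration by parts moves the operator onto \<open>psi n\<close> and flips the sign of
  the derivative. A raising operator on f therefore acts on \<open>psi n\<close> as a lowering one,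
  and conversely. For \<open>n = 0\<close> the factor n hides the truncated index.\<close>

lemma psi_pairing_ladder:
  assumes f: "f \<in> L2 lborel" and g: "g \<in> L2 lborel" and wd: "has_weak_deriv f g"
  shows "(LINT x|lborel. psi n x * (\<omega> * of_real x * f x - (1 / \<omega>) * g x)) = 2 * of_nat n * (LINT x|lborel. psi (n - 1) x * f x)"
    and "(LINT x|lborel. psi n x * (\<omega> * of_real x * f x + (1 / \<omega>) * g x)) = (LINT x|lborel. psi (Suc n) x * f x)"
    and "integrable lborel (\<lambda>x. psi n x * (\<omega> * of_real x * f x - (1 / \<omega>) * g x))"
    and "integrable lborel (\<lambda>x. psi n x * (\<omega> * of_real x * f x + (1 / \<omega>) * g x))"
proof -
  define p where "p = herm \<omega> n"
  let ?G = "gauss (\<omega>\<^sup>2)"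
  have int: "integrable lborel (\<lambda>x. ?G q x * h x)" if "h \<in> L2 lborel" for q h
    by (rule L2_mult_integrable[OF gauss_L2[OF Re_pos] that])
  have minus: "psi n x * (\<omega> * of_real x * f x - (1 / \<omega>) * g x) = ?G ([:0, \<omega>:] * p) x * f x - (1 / \<omega>) * (?G p x * g x)"
    and plus: "psi n x * (\<omega> * of_real x * f x + (1 / \<omega>) * g x) = ?G ([:0, \<omega>:] * p) x * f x + (1 / \<omega>) * (?G p x * g x)" for x
    unfolding gauss_monomial psi_def p_def by (simp_all add: algebra_simps)
  show "integrable lborel (\<lambda>x. psi n x * (\<omega> * of_real x * f x - (1 / \<omega>) * g x))"
    "integrable lborel (\<lambda>x. psi n x * (\<omega> * of_real x * f x + (1 / \<omega>) * g x))"
    unfolding minus plus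
    by (intro Bochner_Integration.integrable_diff Bochner_Integration.integrable_add integrable_mult_right int f g)+
  have ibp: "(LINT x|lborel. ?G p x * g x) = - (LINT x|lborel. ?G (gauss_deriv (\<omega>\<^sup>2) p) x * f x)"
    using weak_deriv_gauss[OF wd f g Re_pos, of p] by simp
  have lin: "(LINT x|lborel. ?G q x * f x) + c * (LINT x|lborel. ?G r x * f x) = (LINT x|lborel. ?G (q + smult c r) x * f x)" for q r c
  proof -
    have "(LINT x|lborel. ?G (q + smult c r) x * f x) = (LINT x|lborel. ?G q x * f x + c * (?G r x * f x))"
      by (simp only: gauss_add gauss_smult distrib_right mult.assoc)
    also have "\<dots> = (LINT x|lborel. ?G q x * f x) + c * (LINT x|lborel. ?G r x * f x)"
      unfolding integral_mult_right_zero[symmetric]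
      by (intro Bochner_Integration.integral_add integrable_mult_right int f)
    finally show ?thesis by simp
  qed
  have X: "smult (1 / \<omega>) ([:0, \<omega>\<^sup>2:] * p) = [:0, \<omega>:] * p"
  proof -
    have "smult (1 / \<omega>) [:0, \<omega>\<^sup>2:] = [:0, \<omega>:]" using nonzero by (simp add: power2_eq_square)
    then show ?thesis by (metis mult_smult_left)
  qed
  have low: "[:0, \<omega>:] * p + smult (1 / \<omega>) (gauss_deriv (\<omega>\<^sup>2) p) = smult (1 / \<omega>) (pderiv p)"
    unfolding gauss_deriv_def smult_diff_right X by (simp add: algebra_simps)
  have high: "[:0, \<omega>:] * p + smult (- (1 / \<omega>)) (gauss_deriv (\<omega>\<^sup>2) p) = herm \<omega> (Suc n)"
  proof -
    have "[:0, \<omega>:] * p + [:0, \<omega>:] * p = [:0, 2 * \<omega>:] * p"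
    proof -
      have "[:0, \<omega>:] + [:0, \<omega>:] = [:0, 2 * \<omega>:]" by simp
      then show ?thesis by (metis distrib_right)
    qed
    then show ?thesis
      unfolding gauss_deriv_def smult_diff_right smult_minus_left X
      by (simp add: p_def algebra_simps)
  qed
  have "(LINT x|lborel. psi n x * (\<omega> * of_real x * f x - (1 / \<omega>) * g x))
      = (LINT x|lborel. ?G ([:0, \<omega>:] * p) x * f x) - (1 / \<omega>) * (LINT x|lborel. ?G p x * g x)"
    unfolding minus integral_mult_right_zero[symmetric]
    by (intro Bochner_Integration.integral_diff integrable_mult_right int f g)
  also have "\<dots> = (LINT x|lborel. ?G (smult (1 / \<omega>) (pderiv p)) x * f x)"
    unfolding ibp low[symmetric] lin[symmetric] by simp
  also have "\<dots> = 2 * of_nat n * (LINT x|lborel. psi (n - 1) x * f x)"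
  proof (cases n)
    case (Suc k)
    show ?thesis
      unfolding p_def Suc pderiv_herm_Suc smult_smult gauss_smult mult.assoc integral_mult_right_zero psi_def
      using nonzero by simp
  qed (simp add: p_def pderiv_1)
  finally show "(LINT x|lborel. psi n x * (\<omega> * of_real x * f x - (1 / \<omega>) * g x)) = 2 * of_nat n * (LINT x|lborel. psi (n - 1) x * f x)" .
  have "(LINT x|lborel. psi n x * (\<omega> * of_real x * f x + (1 / \<omega>) * g x))
      = (LINT x|lborel. ?G ([:0, \<omega>:] * p) x * f x) + (1 / \<omega>) * (LINT x|lborel. ?G p x * g x)"
    unfolding plus integral_mult_right_zero[symmetric]
    by (intro Bochner_Integration.integral_add integrable_mult_right int f g)
  also have "\<dots> = (LINT x|lborel. ?G (herm \<omega> (Suc n)) x * f x)"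
    unfolding ibp high[symmetric] lin[symmetric] by simp
  finally show "(LINT x|lborel. psi n x * (\<omega> * of_real x * f x + (1 / \<omega>) * g x)) = (LINT x|lborel. psi (Suc n) x * f x)"
    by (simp only: psi_def)
qed

text \<open>The denominator is the bilinear square of \<open>psi n\<close>, so subtracting this
  multiple removes the only nonzero coefficient, and completeness finishes.\<close>

lemma psi_single_mode:
  assumes f: "f \<in> L2 lborel" and orth: "\<And>k. k \<noteq> n \<Longrightarrow> (LINT x|lborel. psi k x * f x) = 0"
  shows "AE x in lborel. f x = (LINT x|lborel. psi n x * f x) / (2 ^ n * fact n * kappa) * psi n x"
proof -
  define c where "c = (LINT x|lborel. psi n x * f x) / (2 ^ n * fact n * kappa)"
  have cL: "(\<lambda>x. c * psi n x) \<in> L2 lborel"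
    by (rule L2_dominated[OF psi_L2[of n], where C="norm c"])
      (auto simp: norm_mult psi_def)
  have "AE x in lborel. f x - c * psi n x = 0"
  proof (rule psi_complete[OF L2_diff[OF f cL]])
    fix k
    have "(LINT x|lborel. psi k x * (f x - c * psi n x)) = (LINT x|lborel. psi k x * f x - c * (psi k x * psi n x))"
      by (simp add: algebra_simps)
    also have "\<dots> = (LINT x|lborel. psi k x * f x) - c * (LINT x|lborel. psi k x * psi n x)"
      unfolding integral_mult_right_zero[symmetric]
      by (intro Bochner_Integration.integral_diff integrable_mult_right L2_mult_integrable psi_L2 f)
    also have "\<dots> = 0"
      using orth[of k] kappa_nonzero by (simp add: psi_biorthogonal c_def)
    finally show "(LINT x|lborel. psi k x * (f x - c * psi n x)) = 0" .
  qed
  then show ?thesis by (simp add: c_def)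
qed

text \<open>For \<open>n = 0\<close> the truncated \<open>n - 1\<close> is harmless: components 2 and 4 then vanish.\<close>

definition phi :: "nat \<Rightarrow> 4 \<Rightarrow> real \<Rightarrow> complex" where
  "phi n i = (if i = 1 \<or> i = 3 then psi n else psi (n - 1))"

text \<open>Pairing replaces an equation between weak derivatives by algebra in the coefficients
  \<open>b i k\<close>. Multiplying each relation by E and substituting the others decouples them:
  every coefficient is multiplied by E^2 on one side and by some \<mu> on the other.\<close>

lemma eigenfunction_mode:
  assumes \<omega>: "\<omega> = exp (\<i> * of_real \<theta> / 2)" and "eigenfunction m \<theta> u"
  shows "\<exists>n (a :: complex^4). AE x in lborel. \<forall>i. u x $ i = a $ i * phi n i x"
proof -
  obtain E where u: "u \<in> dom_H" and nz: "\<not> (AE x in lborel. u x = 0)"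
    and E: "AE x in lborel. H_op m \<theta> u x = E *s u x"
    using assms(2) by (auto simp: eigenfunction_def)
  have \<omega>': "exp (- \<i> * of_real \<theta> / 2) = 1 / \<omega>"
    using exp_minus[of "\<i> * of_real \<theta> / 2"] by (simp add: \<omega> inverse_eq_divide)
  define w where "w i = weak_deriv (\<lambda>x. u x $ i)" for i
  note dom = dom_H_weak_deriv[OF u, folded w_def]
  define b where "b i k = (LINT x|lborel. psi k x * u x $ i)" for i k
  have int: "integrable lborel (\<lambda>x. psi k x * u x $ i)" for i k
    by (rule L2_mult_integrable[OF psi_L2 dom(1)])
  note ladder = psi_pairing_ladder[OF dom]
  have comb: "E * b i k = \<alpha> * (LINT x|lborel. psi k x * g x) + \<beta> * b j k"
    if ae: "AE x in lborel. E * u x $ i = \<alpha> * g x + \<beta> * u x $ j"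
      and g: "integrable lborel (\<lambda>x. psi k x * g x)" for i j k \<alpha> \<beta> g
  proof -
    have "E * b i k = (LINT x|lborel. E * (psi k x * u x $ i))" by (simp add: b_def)
    also have "\<dots> = (LINT x|lborel. \<alpha> * (psi k x * g x) + \<beta> * (psi k x * u x $ j))"
    proof (rule integral_cong_AE)
      show "AE x in lborel. E * (psi k x * u x $ i) = \<alpha> * (psi k x * g x) + \<beta> * (psi k x * u x $ j)"
        using ae
      proof eventually_elim
        case (elim x)
        have "E * (psi k x * u x $ i) = psi k x * (E * u x $ i)" by simp
        then show ?case unfolding elim by (simp add: distrib_left mult.left_commute)
      qed
    qed (intro borel_measurable_integrable Bochner_Integration.integrable_add integrable_mult_right int g)+
    also have "\<dots> = \<alpha> * (LINT x|lborel. psi k x * g x) + \<beta> * b j k"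
      unfolding b_def integral_mult_right_zero[symmetric]
      by (intro Bochner_Integration.integral_add integrable_mult_right int g)
    finally show ?thesis .
  qed
  note H = H_op_components[of m \<theta> u, folded \<omega>, unfolded \<omega>', folded w_def]
  have row: "AE x in lborel. H_op m \<theta> u x $ i = E * u x $ i" for i
    using E by eventually_elim simp
  have e1: "E * b 1 k = \<i> * (2 * of_nat k * b 4 (k - 1)) + of_real m * b 3 k" for k
    unfolding ladder(1)[of _ 4, folded b_def, symmetric]
    by (rule comb[OF _ ladder(3)]) (use row[of 1] in eventually_elim, simp add: H(1))
  have e2: "E * b 2 k = - \<i> * b 3 (Suc k) + - of_real m * b 4 k" for k
    unfolding b_def[of 3] ladder(2)[of _ 3, symmetric]
    by (rule comb[OF _ ladder(4)]) (use row[of 2] in eventually_elim, simp add: H(2))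
  have e3: "E * b 3 k = \<i> * (2 * of_nat k * b 2 (k - 1)) + of_real m * b 1 k" for k
    unfolding ladder(1)[of _ 2, folded b_def, symmetric]
    by (rule comb[OF _ ladder(3)]) (use row[of 3] in eventually_elim, simp add: H(3))
  have e4: "E * b 4 k = - \<i> * b 1 (Suc k) + - of_real m * b 2 k" for k
    unfolding b_def[of 1] ladder(2)[of _ 1, symmetric]
    by (rule comb[OF _ ladder(4)]) (use row[of 4] in eventually_elim, simp add: H(4))
  define \<mu> where "\<mu> n = (of_real m)\<^sup>2 + 2 * complex_of_nat n" for n
  have q13: "E\<^sup>2 * b 1 k = \<mu> k * b 1 k" "E\<^sup>2 * b 3 k = \<mu> k * b 3 k" for k
  proof -
    \<comment> \<open>The relations at \<open>k - 1\<close> involve \<open>Suc (k - 1)\<close>,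
      which is k except for \<open>k = 0\<close>; the factor k covers that case.\<close>
    have K: "of_nat k * (E * b 4 (k - 1)) = of_nat k * (- \<i> * b 1 k + - of_real m * b 2 (k - 1))"
      "of_nat k * (E * b 2 (k - 1)) = of_nat k * (- \<i> * b 3 k + - of_real m * b 4 (k - 1))"
      using e4[of "k - 1"] e2[of "k - 1"] by (cases k; simp)+
    have "E\<^sup>2 * b 1 k = \<i> * (2 * (of_nat k * (E * b 4 (k - 1)))) + of_real m * (E * b 3 k)"
      "E\<^sup>2 * b 3 k = \<i> * (2 * (of_nat k * (E * b 2 (k - 1)))) + of_real m * (E * b 1 k)"
      using arg_cong[OF e1[of k], of "(*) E"] arg_cong[OF e3[of k], of "(*) E"]
      by (simp_all add: power2_eq_square algebra_simps)
    then show "E\<^sup>2 * b 1 k = \<mu> k * b 1 k" "E\<^sup>2 * b 3 k = \<mu> k * b 3 k"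
      unfolding K e1 e3 by (simp_all add: \<mu>_def power2_eq_square algebra_simps)
  qed
  have q24: "E\<^sup>2 * b 2 k = \<mu> (Suc k) * b 2 k" "E\<^sup>2 * b 4 k = \<mu> (Suc k) * b 4 k" for k
  proof -
    have "E\<^sup>2 * b 2 k = - \<i> * (E * b 3 (Suc k)) + - of_real m * (E * b 4 k)"
      "E\<^sup>2 * b 4 k = - \<i> * (E * b 1 (Suc k)) + - of_real m * (E * b 2 k)"
      using arg_cong[OF e2[of k], of "(*) E"] arg_cong[OF e4[of k], of "(*) E"]
      by (simp_all add: power2_eq_square algebra_simps)
    then show "E\<^sup>2 * b 2 k = \<mu> (Suc k) * b 2 k" "E\<^sup>2 * b 4 k = \<mu> (Suc k) * b 4 k"
      by (simp_all add: e1 e2 e3 e4 \<mu>_def power2_eq_square algebra_simps)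
  qed
  have four: "\<forall>i::4. P i" if "P 1" "P 2" "P 3" "P 4" for P
    using that by (simp add: forall_4)
  \<comment> \<open>Otherwise all coefficients vanish, and by completeness so does u.\<close>
  have "\<exists>n. E\<^sup>2 = \<mu> n"
  proof (rule ccontr)
    assume "\<nexists>n. E\<^sup>2 = \<mu> n"
    then have "\<forall>i. \<forall>k. b i k = 0" using q13 q24 by (intro four) auto
    then have "AE x in lborel. u x $ i = 0" for i
      by (intro psi_complete dom(1)) (simp add: b_def)
    then have "AE x in lborel. \<forall>i. u x $ i = 0" by (subst AE_all_countable) blast
    then have "AE x in lborel. u x = 0" by eventually_elim (simp add: vec_eq_iff)
    then show False using nz by blast
  qed
  then obtain n where n: "E\<^sup>2 = \<mu> n" by blast
  \<comment> \<open>Injectivity makes E^2 select a single level; the two signs of E share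
    it.\<close>
  have \<mu>_inj: "\<mu> k = \<mu> l \<longleftrightarrow> k = l" for k l by (simp add: \<mu>_def)
  have single: "\<exists>c. AE x in lborel. u x $ i = c * psi l x" if "\<And>k. k \<noteq> l \<Longrightarrow> b i k = 0" for i l
    using psi_single_mode[OF dom(1)[of i], of l] that unfolding b_def by blast
  have "\<forall>i. \<exists>c. AE x in lborel. u x $ i = c * phi n i x"
  proof (rule four)
    show "\<exists>c. AE x in lborel. u x $ 1 = c * phi n 1 x" "\<exists>c. AE x in lborel. u x $ 3 = c * phi n 3 x"
      unfolding phi_def using q13 by (auto intro!: single simp: n \<mu>_inj)
    have "b 2 k = 0" "b 4 k = 0" if "k \<noteq> n - 1" for k
      using q24[of k] that by (auto simp: n \<mu>_inj)
    then show "\<exists>c. AE x in lborel. u x $ 2 = c * phi n 2 x" "\<exists>c. AE x in lborel. u x $ 4 = c * phi n 4 x"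
      unfolding phi_def by (auto intro!: single)
  qed
  then obtain c where c: "\<And>i. AE x in lborel. u x $ i = c i * phi n i x" by metis
  then have "AE x in lborel. \<forall>i. u x $ i = (\<chi> i. c i) $ i * phi n i x"
    by (subst AE_all_countable) simp
  then show ?thesis by blast
qed

end

section \<open>Expansions in eigenfunctions\<close>

text \<open>Dependence in the vector space concerns sets, while a family may repeat a vector; a
  repetition gives the relation with coefficients 1 and -1.\<close>

lemma vector_family_dependent:
  fixes a :: "'i \<Rightarrow> complex^'n"
  assumes J: "finite J" "CARD('n) < card J"
  shows "\<exists>c. (\<exists>j\<in>J. c j \<noteq> 0) \<and> (\<Sum>j\<in>J. c j *s a j) = 0"
proof (cases "inj_on a J")
  case True
  have "vec.dependent (a ` J)"
  proof (rule ccontr)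
    assume "vec.independent (a ` J)"
    then have "card (a ` J) \<le> vec.dim (UNIV :: (complex^'n) set)"
      by (intro vec.independent_card_le_dim) auto
    then have "card (a ` J) \<le> CARD('n)" by (simp only: vec_dim_card)
    then show False using J card_image[OF True] by simp
  qed
  then obtain u where u: "\<exists>v\<in>a ` J. u v \<noteq> 0" "(\<Sum>v\<in>a ` J. u v *s v) = 0"
    using vec.dependent_finite[of "a ` J"] J by auto
  then show ?thesis
    using sum.reindex[OF True, of "\<lambda>v. u v *s v"] by (intro exI[of _ "u \<circ> a"]) auto
next
  case False
  then obtain i k where ik: "i \<in> J" "k \<in> J" "i \<noteq> k" "a i = a k" by (auto simp: inj_on_def)
  define c where "c j = (if j = i then 1 else if j = k then - 1 else 0 :: complex)" for j
  have "(\<Sum>j\<in>J. c j *s a j) = (\<Sum>j\<in>{i, k}. c j *s a j)"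
    using ik J by (intro sum.mono_neutral_right) (auto simp: c_def)
  also have "\<dots> = 0" using ik by (simp add: c_def)
  finally show ?thesis using ik by (intro exI[of _ c]) (auto simp: c_def)
qed

text \<open>Padded with zeros, a vanishing finite combination is an expansion of the zero function,
  as is the trivial one; uniqueness compares them.\<close>

lemma schauder_basis_finite_independent:
  assumes "schauder_basis e" and J: "finite J" and zero: "AE x in lborel. (\<Sum>j\<in>J. c j *s e j x) = 0"
    and "j \<in> J"
  shows "c j = 0"
proof -
  have eL: "\<And>n. e n \<in> L2 lborel" using assms(1) by (simp add: schauder_basis_def)
  have ex1: "\<exists>!c. (\<lambda>N. l2norm (\<lambda>x. 0 - (\<Sum>n<N. c n *s e n x))) \<longlonglongrightarrow> 0"
    by (rule bspec[OF conjunct2[OF assms(1)[unfolded schauder_basis_def]] L2_zero])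
  define d where "d n = (if n \<in> J then c n else 0)" for n
  have "(\<lambda>N. l2norm (\<lambda>x. 0 - (\<Sum>n<N. d n *s e n x))) \<longlonglongrightarrow> 0"
  proof (rule tendsto_eventually)
    obtain M where M: "\<And>n. n \<in> J \<Longrightarrow> n < M" using J finite_nat_iff_bounded by auto
    show "\<forall>\<^sub>F N in sequentially. l2norm (\<lambda>x. 0 - (\<Sum>n<N. d n *s e n x)) = 0"
      using eventually_ge_at_top[of M]
    proof eventually_elim
      case (elim N)
      have "(\<Sum>n<N. d n *s e n x) = (\<Sum>j\<in>J. c j *s e j x)" for x
      proof -
        have "(\<Sum>n<N. d n *s e n x) = (\<Sum>n\<in>J. d n *s e n x)"
          using M elim by (intro sum.mono_neutral_right) (auto simp: d_def dest: less_le_trans)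
        then show ?thesis by (simp add: d_def)
      qed
      then have "AE x in lborel. 0 - (\<Sum>n<N. d n *s e n x) = 0" using zero by simp
      then show ?case
        by (rule iffD2[OF l2norm_eq_0[OF L2_diff[OF L2_zero L2_smult_sum[where e=e and c=d and I="{..<N}", OF eL]]]])
    qed
  qed
  moreover have "(\<lambda>N. l2norm (\<lambda>x. 0 - (\<Sum>n<N. (\<lambda>_. 0) n *s e n x))) \<longlonglongrightarrow> 0"
    by (simp add: l2norm_def)
  ultimately have "d = (\<lambda>_. 0)" by (rule Uniq_D[OF conjunct2[OF ex1[unfolded ex1_iff_ex_Uniq]]])
  then have "d j = 0" by simp
  then show ?thesis using \<open>j \<in> J\<close> by (simp add: d_def)
qed

text \<open>Each term is the difference of consecutive partial sums, which stay within a bounded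
  distance of F.\<close>

lemma schauder_expansion_terms_bounded:
  assumes eL: "\<And>n. e n \<in> L2 lborel" and F: "F \<in> L2 lborel"
    and lim: "(\<lambda>N. l2norm (\<lambda>x. F x - (\<Sum>n<N. c n *s e n x))) \<longlonglongrightarrow> 0"
  shows "\<exists>K\<ge>0. \<forall>n. norm (c n) * l2norm (e n :: real \<Rightarrow> complex^'n) \<le> K"
proof -
  define s where "s N x = (\<Sum>n<N. c n *s e n x)" for N x
  have sL: "s N \<in> L2 lborel" for N unfolding s_def by (rule L2_smult_sum[OF eL])
  have "Bseq (\<lambda>N. l2norm (\<lambda>x. F x - s N x))"
    using lim unfolding s_def by (intro convergent_imp_Bseq) (auto simp: convergent_def)
  then obtain K where K: "0 < K" "\<And>N. norm (l2norm (\<lambda>x. F x - s N x)) \<le> K" by (auto elim: BseqE)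
  have "norm (c n) * l2norm (e n) \<le> 2 * K" for n
  proof -
    have "norm (c n) * l2norm (e n) = l2norm (\<lambda>x. s (Suc n) x - s n x)"
      by (simp add: s_def l2norm_smult)
    also have "\<dots> \<le> l2norm (\<lambda>x. s (Suc n) x - F x) + l2norm (\<lambda>x. F x - s n x)"
      by (rule l2norm_triangle_sub[OF sL F sL])
    also have "\<dots> \<le> K + K"
      using K(2)[of n] K(2)[of "Suc n"] l2norm_minus_commute[of F "s (Suc n)"] by (intro add_mono) auto
    finally show ?thesis by simp
  qed
  then show ?thesis using K(1) by (intro exI[of _ "2 * K"]) auto
qed

section \<open>Pairing an expansion with one Hermite level\<close>

context rotated_hermite
begin

text \<open>The left side is the modulus of the bilinear square of \<open>psi n\<close>; without
  conjugation it can only be smaller than the squared norm.\<close>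

lemma psi_l2norm_ge: "norm (2 ^ n * fact n * kappa) \<le> (l2norm (psi n))\<^sup>2"
proof -
  have "norm (2 ^ n * fact n * kappa) = norm (LINT x|lborel. psi n x * psi n x)"
    by (simp add: psi_biorthogonal)
  also have "\<dots> \<le> (LINT x|lborel. norm (psi n x * psi n x))" by (rule integral_norm_bound)
  also have "\<dots> = (l2norm (psi n))\<^sup>2"
    unfolding l2norm_squared by (simp add: norm_mult power2_eq_square)
  finally show ?thesis .
qed

lemma not_schauder_basis_of_modes:
  assumes im: "Im (\<omega>\<^sup>2) \<noteq> 0"
    and mode: "\<And>j. AE x in lborel. \<forall>i. e j x $ i = (a j :: complex^4) $ i * phi (level j) i x"
  shows "\<not> schauder_basis e"
proof
  assume basis: "schauder_basis e"
  then have eL: "\<And>n. e n \<in> L2 lborel" by (simp add: schauder_basis_def)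
  \<comment> \<open>Chosen so that \<open>Re (\<omega>\<^sup>2 * cnj \<beta>) < 0\<close>, i.e. \<open>|\<omega>\<^sup>2 + \<beta>| < |\<omega>\<^sup>2 - \<beta>|\<close>.\<close>
  define \<beta> where "\<beta> = Complex 1 (- 2 * Re (\<omega>\<^sup>2) / Im (\<omega>\<^sup>2))"
  have \<beta>: "0 < Re \<beta>" by (simp add: \<beta>_def)
  have \<rho>: "1 < norm ((\<omega>\<^sup>2 - \<beta>) / (\<omega>\<^sup>2 + \<beta>))"
  proof -
    have p: "0 < Re (\<omega>\<^sup>2 + \<beta>)" using Re_pos \<beta> by simp
    then have "\<omega>\<^sup>2 + \<beta> \<noteq> 0" by (metis less_irrefl zero_complex.sel(1))
    \<comment> \<open>The left side equals \<open>- Re (\<omega>\<^sup>2)\<close>.\<close>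
    have "Re \<beta> * Re (\<omega>\<^sup>2) + Im \<beta> * Im (\<omega>\<^sup>2) < 0" using im Re_pos by (simp add: \<beta>_def)
    then have "(norm (\<omega>\<^sup>2 + \<beta>))\<^sup>2 < (norm (\<omega>\<^sup>2 - \<beta>))\<^sup>2"
      unfolding cmod_power2 minus_complex.simps plus_complex.simps
      by (simp add: power2_sum power2_diff)
    then have "norm (\<omega>\<^sup>2 + \<beta>) < norm (\<omega>\<^sup>2 - \<beta>)" by (rule power2_less_imp_less) simp
    then show ?thesis using \<open>\<omega>\<^sup>2 + \<beta> \<noteq> 0\<close> by (simp add: norm_divide)
  qed
  \<comment> \<open>Only component 1 is occupied, where \<open>phi\<close> at level n is
    \<open>psi n\<close> itself.\<close>
  define F :: "real \<Rightarrow> complex^4" where "F x = gauss \<beta> 1 x *s axis 1 1" for x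
  have FL: "F \<in> L2 lborel"
  proof -
    have "continuous_on UNIV (\<lambda>z. z *s (axis 1 1 :: complex^4))"
      unfolding vector_scalar_mult_def by (intro continuous_intros)
    then have [measurable]: "(\<lambda>z. z *s (axis 1 1 :: complex^4)) \<in> borel_measurable borel"
      by (rule borel_measurable_continuous_onI)
    have "F \<in> borel_measurable lborel" unfolding F_def by measurable
    then show ?thesis
      by (rule L2_dominated[OF gauss_L2[OF \<beta>, of 1], where C=1])
        (simp add: F_def norm_vector_smult norm_axis_1)
  qed
  have F1: "F x $ 1 = gauss \<beta> 1 x" for x by (simp add: F_def axis_def)
  obtain c where lim: "(\<lambda>N. l2norm (\<lambda>x. F x - (\<Sum>n<N. c n *s e n x))) \<longlonglongrightarrow> 0"
    using ex1_implies_ex[OF bspec[OF conjunct2[OF basis[unfolded schauder_basis_def]] FL]] by blast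
  obtain K where K: "0 \<le> K" "\<And>j. norm (c j) * l2norm (e j) \<le> K"
    using schauder_expansion_terms_bounded[OF eL FL lim] by blast
  define d where "d n = 2 ^ n * fact n * kappa" for n
  define P where "P n h = (LINT x|lborel. psi n x * h x $ 1)" for n and h :: "real \<Rightarrow> complex^4"
  have Pint: "integrable lborel (\<lambda>x. psi n x * h x $ 1)" if "h \<in> L2 lborel" for n and h :: "real \<Rightarrow> complex^4"
    by (rule L2_mult_integrable[OF psi_L2 L2_nth[OF that]])
  have e1: "AE x in lborel. e j x $ 1 = a j $ 1 * psi (level j) x" for j
    using mode[of j] by eventually_elim (simp add: phi_def)
  have e1L: "(\<lambda>x. a j $ 1 * psi (level j) x) \<in> L2 lborel" for j
    by (rule L2_dominated[OF psi_L2, where C="norm (a j $ 1)"]) (auto simp: norm_mult psi_def)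
  have Pe: "P n (e j) = (if level j = n then a j $ 1 * d n else 0)" for n j
  proof -
    have "P n (e j) = (LINT x|lborel. a j $ 1 * (psi n x * psi (level j) x))"
      unfolding P_def
    proof (rule integral_cong_AE)
      show "AE x in lborel. psi n x * e j x $ 1 = a j $ 1 * (psi n x * psi (level j) x)"
        using e1[of j] by eventually_elim simp
    qed (intro borel_measurable_integrable Pint eL integrable_mult_right L2_mult_integrable psi_L2)+
    then show ?thesis by (simp add: psi_biorthogonal d_def)
  qed
  \<comment> \<open>The norm of \<open>e j\<close> controls |a| times the norm of
    \<open>psi n\<close>, whereas the pairing is |a| |d n|. Splitting |d n| into two square roots,
    one of them at most the norm of \<open>psi n\<close>, closes the estimate.\<close>
  have term_bound: "norm (c j * P n (e j)) \<le> (if level j = n then K * sqrt (norm (d n)) else 0)" for n j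
  proof (cases "level j = n")
    case True
    have "norm (a j $ 1) * l2norm (psi n) = l2norm (\<lambda>x. a j $ 1 * psi n x)"
      by (simp add: l2norm_def norm_mult power_mult_distrib real_sqrt_mult)
    also have "\<dots> = l2norm (\<lambda>x. e j x $ 1)"
      using l2norm_cong_AE[OF L2_measurable[OF L2_nth[OF eL]] L2_measurable[OF e1L] e1, of j] True by simp
    also have "\<dots> \<le> l2norm (e j)" by (rule l2norm_nth_le[OF eL])
    finally have le: "norm (a j $ 1) * l2norm (psi n) \<le> l2norm (e j)" .
    have "norm (d n) = sqrt (norm (d n)) * sqrt (norm (d n))" by simp
    also have "\<dots> \<le> l2norm (psi n) * sqrt (norm (d n))"
      using psi_l2norm_ge[of n] by (intro mult_right_mono real_le_lsqrt) (auto simp: d_def)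
    finally have "norm (c j * P n (e j)) \<le> norm (c j) * (norm (a j $ 1) * (l2norm (psi n) * sqrt (norm (d n))))"
      unfolding Pe norm_mult[of "c j"] using True by (simp add: norm_mult mult_left_mono)
    also have "\<dots> = norm (c j) * (norm (a j $ 1) * l2norm (psi n)) * sqrt (norm (d n))" by simp
    also have "\<dots> \<le> norm (c j) * l2norm (e j) * sqrt (norm (d n))"
      by (intro mult_right_mono mult_left_mono le) auto
    also have "\<dots> \<le> K * sqrt (norm (d n))" by (intro mult_right_mono K) auto
    finally show ?thesis using True by simp
  qed (simp add: Pe)
  \<comment> \<open>On one level the eigenfunctions depend linearly on their vectors
    \<open>a j\<close> in a four-dimensional space, so five of them would be dependent.\<close>
  have card: "card J \<le> 4" if J: "finite J" "\<And>j. j \<in> J \<Longrightarrow> level j = n" for J n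
  proof (rule ccontr)
    assume "\<not> card J \<le> 4"
    then obtain b where b: "\<exists>j\<in>J. b j \<noteq> 0" "(\<Sum>j\<in>J. b j *s a j) = 0"
      using vector_family_dependent[OF J(1), of a] by auto
    have "AE x in lborel. \<forall>j. \<forall>i. e j x $ i = a j $ i * phi (level j) i x"
      using mode by (subst AE_all_countable) blast
    then have "AE x in lborel. (\<Sum>j\<in>J. b j *s e j x) = 0"
    proof eventually_elim
      case (elim x)
      have "(\<Sum>j\<in>J. b j *s e j x) $ i = (\<Sum>j\<in>J. b j *s a j) $ i * phi n i x" for i
        using elim J(2) by (simp add: sum_distrib_right mult.assoc)
      then show ?case using b(2) by (simp add: vec_eq_iff)
    qed
    then show False using schauder_basis_finite_independent[OF basis J(1), of b] b(1) by blast
  qed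
  \<comment> \<open>The partial sums satisfy the bound uniformly in N. With n fixed, the remainder
    paired with \<open>psi n\<close> tends to 0, so the bound passes to F.\<close>
  have bound: "norm (P n F) \<le> 4 * K * sqrt (norm (d n))" for n
  proof -
    have "norm (P n F) \<le> 4 * K * sqrt (norm (d n)) + l2norm (psi n) * l2norm (\<lambda>x. F x - (\<Sum>j<N. c j *s e j x))" for N
    proof -
      define S where "S x = (\<Sum>j<N. c j *s e j x)" for x
      have SL: "S \<in> L2 lborel" unfolding S_def by (rule L2_smult_sum[OF eL])
      have "P n S = (LINT x|lborel. (\<Sum>j<N. c j * (psi n x * e j x $ 1)))"
        unfolding P_def S_def by (simp add: sum_distrib_left mult.left_commute)
      also have "\<dots> = (\<Sum>j<N. LINT x|lborel. c j * (psi n x * e j x $ 1))"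
        by (rule Bochner_Integration.integral_sum) (intro integrable_mult_right Pint eL)
      also have "\<dots> = (\<Sum>j<N. c j * P n (e j))" by (simp add: P_def)
      finally have "norm (P n S) \<le> (\<Sum>j<N. norm (c j * P n (e j)))" by (simp only: norm_sum)
      also have "\<dots> \<le> (\<Sum>j<N. if level j = n then K * sqrt (norm (d n)) else 0)"
        by (intro sum_mono term_bound)
      also have "\<dots> = real (card {j \<in> {..<N}. level j = n}) * (K * sqrt (norm (d n)))"
        by (simp flip: sum.inter_filter)
      also have "\<dots> \<le> 4 * (K * sqrt (norm (d n)))"
      proof (rule mult_right_mono)
        have "card {j \<in> {..<N}. level j = n} \<le> 4" by (rule card[where n=n]) simp_all
        then show "real (card {j \<in> {..<N}. level j = n}) \<le> 4" by simp
      qed (simp add: K(1))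
      finally have PS: "norm (P n S) \<le> 4 * K * sqrt (norm (d n))" by simp
      have D: "(\<lambda>x. F x - S x) \<in> L2 lborel" by (rule L2_diff[OF FL SL])
      have "P n F - P n S = (LINT x|lborel. psi n x * F x $ 1 - psi n x * S x $ 1)"
        unfolding P_def by (rule Bochner_Integration.integral_diff[symmetric]) (intro Pint FL SL)+
      also have "\<dots> = (LINT x|lborel. psi n x * (F x - S x) $ 1)" by (simp add: right_diff_distrib)
      finally have "norm (P n F - P n S) \<le> (LINT x|lborel. norm (psi n x * (F x - S x) $ 1))"
        by (simp only: integral_norm_bound)
      also have "\<dots> \<le> l2norm (psi n) * l2norm (\<lambda>x. (F x - S x) $ 1)"
        unfolding norm_mult by (rule L2_Cauchy_Schwarz[OF psi_L2 L2_nth[OF D]])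
      also have "\<dots> \<le> l2norm (psi n) * l2norm (\<lambda>x. F x - S x)"
        by (intro mult_left_mono l2norm_nth_le[OF D]) simp
      finally have "norm (P n F - P n S) \<le> l2norm (psi n) * l2norm (\<lambda>x. F x - S x)" .
      then show ?thesis
        using PS norm_triangle_sub[of "P n F" "P n S"] unfolding S_def by linarith
    qed
    moreover have "(\<lambda>N. 4 * K * sqrt (norm (d n)) + l2norm (psi n) * l2norm (\<lambda>x. F x - (\<Sum>j<N. c j *s e j x)))
        \<longlonglongrightarrow> 4 * K * sqrt (norm (d n)) + 0"
      by (intro tendsto_add tendsto_const tendsto_mult_right_zero lim)
    ultimately have "norm (P n F) \<le> 4 * K * sqrt (norm (d n)) + 0"
      by (intro LIMSEQ_le_const[where a="norm (P n F)"]) blast+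
    then show ?thesis by simp
  qed
  \<comment> \<open>The constant is the square of \<open>4 * K\<close> times the factor
    \<open>norm kappa\<close> contained in \<open>norm (d n)\<close>.\<close>
  obtain n where n: "(16 * K\<^sup>2 * norm kappa) * (2 ^ n * fact n) < (norm (LINT x|lborel. psi n x * gauss \<beta> 1 x))\<^sup>2"
    using psi_gauss_overlap_unbounded[OF \<beta> \<rho>] by blast
  have "(norm (LINT x|lborel. psi n x * gauss \<beta> 1 x))\<^sup>2 \<le> (4 * K * sqrt (norm (d n)))\<^sup>2"
    using bound[of n] unfolding P_def F1 by (intro power_mono) auto
  also have "\<dots> = (16 * K\<^sup>2 * norm kappa) * (2 ^ n * fact n)"
    by (simp add: power_mult_distrib d_def norm_mult norm_power)
  finally show False using n by simp
qed

end

theorem mainTheorem5: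
  fixes m \<theta> :: real
  assumes "m \<ge> 0" and "- (pi / 2) < \<theta>" and "\<theta> < pi / 2" and "\<theta> \<noteq> 0"
  shows "\<not> (\<exists>e :: nat \<Rightarrow> real \<Rightarrow> complex^4.
            (\<forall>n. eigenfunction m \<theta> (e n)) \<and> (riesz_basis e \<or> schauder_basis e))"
proof
  assume "\<exists>e :: nat \<Rightarrow> real \<Rightarrow> complex^4.
            (\<forall>n. eigenfunction m \<theta> (e n)) \<and> (riesz_basis e \<or> schauder_basis e)"
  then obtain e where e: "\<And>n. eigenfunction m \<theta> (e n)" and "schauder_basis e"
    using riesz_basis_imp_schauder_basis by blast
  define \<omega> where "\<omega> = exp (\<i> * of_real \<theta> / 2)"
  have "\<omega>\<^sup>2 = cis \<theta>"
    unfolding \<omega>_def by (simp add: cis_conv_exp flip: exp_double)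
  moreover have "sin \<theta> \<noteq> 0"
    using assms sin_eq_0_pi[of \<theta>] pi_gt_zero by linarith
  moreover have "0 < cos \<theta>" using assms by (intro cos_gt_zero_pi) auto
  ultimately have re: "0 < Re (\<omega>\<^sup>2)" and im: "Im (\<omega>\<^sup>2) \<noteq> 0" by auto
  interpret rotated_hermite \<omega> by unfold_locales (rule re)
  have "\<forall>j. \<exists>n (a :: complex^4). AE x in lborel. \<forall>i. e j x $ i = a $ i * phi n i x"
    using eigenfunction_mode[OF \<omega>_def e] by blast
  from choice[OF this] obtain level
    where "\<forall>j. \<exists>a :: complex^4. AE x in lborel. \<forall>i. e j x $ i = a $ i * phi (level j) i x" ..
  from choice[OF this] obtain a :: "nat \<Rightarrow> complex^4"
    where "\<forall>j. AE x in lborel. \<forall>i. e j x $ i = a j $ i * phi (level j) i x" ..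
  with \<open>schauder_basis e\<close> show False
    using not_schauder_basis_of_modes[OF im, of e a level] by simp
qed

end
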